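(* Let $\mathbb{W}$ be a 2-category with finite products, equipped with a notion of discreteness, and let $A \in \mathbb{W}$ be an object that is internally cartesian closed. Then for every discrete object $X \in \mathit{Disc}(\mathbb{W})$ the category $\hom_{\mathbb{W}}(X, A)$ is cartesian closed. Moreover, if $A$ is internally cocartesian (i.e. has an internal initial value and internal binary coproducts), then for every discrete object $X \in \mathit{Disc}(\mathbb{W})$ the category $\hom_{\mathbb{W}}(X, A)$ has finite coproducts.
   Context: 2-categories are strict; finite products in a 2-category are 2-products. A notion of discreteness on a 2-category $\mathbb{W}$ is given by a 1-category $\mathbb{C}$ and a functor $F\colon \mathbb{C} \to \mathbb{W}$ that is 2-fully faithful (each $\hom_{\mathbb{C}}(X,Y)\to\hom_{\mathbb{W}}(FX,FY)$ is an isomorphism of categories, the domain being regarded as a discrete category; so there are no non-trivial 2-morphisms in the full subcategory on the image of $F$) and is left adjoint, as a functor of underlying 1-categories, to a 1-functor $U\colon \mathbb{W}\to\mathbb{C}$, such that the unit of the adjunction is an isomorphism. One identifies $\mathbb{C}$ with the full image of $F$, denoted $\mathit{Disc}(\mathbb{W})$; its objects are the discrete objects. Write $|A| = F(U(A))$ and $\epsilon_A\colon |A| \to A$ for the counit. An object $A$ of a 2-category with finite products has an internal terminal value (initial value) if the unique morphism $!\colon A \to 1$ has a right (resp. left) adjoint in $\mathbb{W}$; it has internal products (coproducts) if the diagonal $\Delta_A\colon A \to A\times A$ has a right adjoint $\times_A\colon A\times A\to A$ (resp. left adjoint $\sqcup_A\colon A \times A\to A$). $A$ is internally cartesian closed if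 it has an internal terminal value, internal products, and the morphism $\langle \times_A\circ(\mathit{id}\times\epsilon_A), \pi_{|A|}\rangle\colon A\times|A| \to A\times|A|$ has a right adjoint in $\mathbb{W}$. *)

theory Defs
  imports Main
begin

section \<open>Categories and functors\<close>

record ('o, 'a) cat =
  Obj :: "'o set"
  Arr :: "'a set"
  Dom :: "'a \<Rightarrow> 'o"
  Cod :: "'a \<Rightarrow> 'o"
  Idt :: "'o \<Rightarrow> 'a"
  Cmp :: "'a \<Rightarrow> 'a \<Rightarrow> 'a"
    \<comment> \<open>\<open>Cmp C g f\<close> is \<open>g\<close> after \<open>f\<close>; outside the composable pairs in \<open>Arr C\<close> its value is irrelevant\<close>

definition hom :: "('o, 'a, 'z) cat_scheme \<Rightarrow> 'o \<Rightarrow> 'o \<Rightarrow> 'a set" where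
  "hom C x y = {f \<in> Arr C. Dom C f = x \<and> Cod C f = y}"

locale category =
  fixes C :: "('o, 'a, 'z) cat_scheme"
  assumes Dom_in_Obj: "f \<in> Arr C \<Longrightarrow> Dom C f \<in> Obj C"
    and Cod_in_Obj: "f \<in> Arr C \<Longrightarrow> Cod C f \<in> Obj C"
    and Idt_in_hom: "x \<in> Obj C \<Longrightarrow> Idt C x \<in> hom C x x"
    and Cmp_in_hom: "\<lbrakk>f \<in> hom C x y; g \<in> hom C y z\<rbrakk> \<Longrightarrow> Cmp C g f \<in> hom C x z"
    and Cmp_Idt_left: "f \<in> hom C x y \<Longrightarrow> Cmp C (Idt C y) f = f"
    and Cmp_Idt_right: "f \<in> hom C x y \<Longrightarrow> Cmp C f (Idt C x) = f"
    and Cmp_assoc: "\<lbrakk>f \<in> hom C w x; g \<in> hom C x y; h \<in> hom C y z\<rbrakk>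
          \<Longrightarrow> Cmp C (Cmp C h g) f = Cmp C h (Cmp C g f)"

definition is_functor ::
  "('o1, 'a1, 'z1) cat_scheme \<Rightarrow> ('o2, 'a2, 'z2) cat_scheme \<Rightarrow> ('o1 \<Rightarrow> 'o2) \<Rightarrow> ('a1 \<Rightarrow> 'a2) \<Rightarrow> bool" where
  "is_functor C D Fo Fa \<longleftrightarrow>
     category C \<and> category D \<and>
     (\<forall>x\<in>Obj C. Fo x \<in> Obj D) \<and>
     (\<forall>f\<in>Arr C. Fa f \<in> hom D (Fo (Dom C f)) (Fo (Cod C f))) \<and>
     (\<forall>x\<in>Obj C. Fa (Idt C x) = Idt D (Fo x)) \<and>
     (\<forall>f\<in>Arr C. \<forall>g\<in>Arr C. Cod C f = Dom C g \<longrightarrow> Fa (Cmp C g f) = Cmp D (Fa g) (Fa f))"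

definition is_cat_iso ::
  "('o1, 'a1, 'z1) cat_scheme \<Rightarrow> ('o2, 'a2, 'z2) cat_scheme \<Rightarrow> ('o1 \<Rightarrow> 'o2) \<Rightarrow> ('a1 \<Rightarrow> 'a2) \<Rightarrow> bool" where
  "is_cat_iso C D Fo Fa \<longleftrightarrow>
     is_functor C D Fo Fa \<and>
     (\<exists>Go Ga. is_functor D C Go Ga \<and>
        (\<forall>x\<in>Obj C. Go (Fo x) = x) \<and> (\<forall>f\<in>Arr C. Ga (Fa f) = f) \<and>
        (\<forall>y\<in>Obj D. Fo (Go y) = y) \<and> (\<forall>g\<in>Arr D. Fa (Ga g) = g))"

definition is_iso :: "('o, 'a, 'z) cat_scheme \<Rightarrow> 'a \<Rightarrow> bool" where
  "is_iso C f \<longleftrightarrow> f \<in> Arr C \<and>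
     (\<exists>g\<in>hom C (Cod C f) (Dom C f).
        Cmp C g f = Idt C (Dom C f) \<and> Cmp C f g = Idt C (Cod C f))"

definition natural_transformation ::
  "('o1, 'a1, 'z1) cat_scheme \<Rightarrow> ('o2, 'a2, 'z2) cat_scheme \<Rightarrow>
   ('o1 \<Rightarrow> 'o2) \<Rightarrow> ('a1 \<Rightarrow> 'a2) \<Rightarrow> ('o1 \<Rightarrow> 'o2) \<Rightarrow> ('a1 \<Rightarrow> 'a2) \<Rightarrow> ('o1 \<Rightarrow> 'a2) \<Rightarrow> bool" where
  "natural_transformation C D Fo Fa Go Ga \<tau> \<longleftrightarrow>
     is_functor C D Fo Fa \<and> is_functor C D Go Ga \<and>
     (\<forall>x\<in>Obj C. \<tau> x \<in> hom D (Fo x) (Go x)) \<and>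
     (\<forall>f\<in>Arr C. Cmp D (\<tau> (Cod C f)) (Fa f) = Cmp D (Ga f) (\<tau> (Dom C f)))"

definition functor_adjunction ::
  "('o1, 'a1, 'z1) cat_scheme \<Rightarrow> ('o2, 'a2, 'z2) cat_scheme \<Rightarrow>
   ('o1 \<Rightarrow> 'o2) \<Rightarrow> ('a1 \<Rightarrow> 'a2) \<Rightarrow> ('o2 \<Rightarrow> 'o1) \<Rightarrow> ('a2 \<Rightarrow> 'a1) \<Rightarrow>
   ('o1 \<Rightarrow> 'a1) \<Rightarrow> ('o2 \<Rightarrow> 'a2) \<Rightarrow> bool" where
  "functor_adjunction C D Fo Fa Uo Ua \<eta> \<epsilon> \<longleftrightarrow>
     is_functor C D Fo Fa \<and> is_functor D C Uo Ua \<and>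
     natural_transformation C C (\<lambda>x. x) (\<lambda>f. f) (\<lambda>x. Uo (Fo x)) (\<lambda>f. Ua (Fa f)) \<eta> \<and>
     natural_transformation D D (\<lambda>y. Fo (Uo y)) (\<lambda>g. Fa (Ua g)) (\<lambda>y. y) (\<lambda>g. g) \<epsilon> \<and>
     (\<forall>x\<in>Obj C. Cmp D (\<epsilon> (Fo x)) (Fa (\<eta> x)) = Idt D (Fo x)) \<and>
     (\<forall>y\<in>Obj D. Cmp C (Ua (\<epsilon> y)) (\<eta> (Uo y)) = Idt C (Uo y))"

definition unit_cat :: "(unit, unit) cat" where
  "unit_cat = \<lparr>Obj = {()}, Arr = {()}, Dom = (\<lambda>_. ()), Cod = (\<lambda>_. ()),
     Idt = (\<lambda>_. ()), Cmp = (\<lambda>_ _. ())\<rparr>"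

definition prod_cat ::
  "('o1, 'a1, 'z1) cat_scheme \<Rightarrow> ('o2, 'a2, 'z2) cat_scheme \<Rightarrow> ('o1 \<times> 'o2, 'a1 \<times> 'a2) cat" where
  "prod_cat C D = \<lparr>Obj = Obj C \<times> Obj D, Arr = Arr C \<times> Arr D,
     Dom = map_prod (Dom C) (Dom D), Cod = map_prod (Cod C) (Cod D),
     Idt = map_prod (Idt C) (Idt D),
     Cmp = (\<lambda>(g, g') (f, f'). (Cmp C g f, Cmp D g' f'))\<rparr>"

text \<open>Each element of \<open>S\<close> serves both as an object and as the identity arrow of that object.\<close>

definition discrete_cat :: "'s set \<Rightarrow> ('s, 's) cat" where
  "discrete_cat S = \<lparr>Obj = S, Arr = S, Dom = (\<lambda>s. s), Cod = (\<lambda>s. s),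
     Idt = (\<lambda>s. s), Cmp = (\<lambda>t s. s)\<rparr>"


section \<open>Limits, colimits and exponentials in a category\<close>

definition is_product ::
  "('o, 'a, 'z) cat_scheme \<Rightarrow> 'i set \<Rightarrow> ('i \<Rightarrow> 'o) \<Rightarrow> 'o \<Rightarrow> ('i \<Rightarrow> 'a) \<Rightarrow> bool" where
  "is_product C I d p \<pi> \<longleftrightarrow>
     p \<in> Obj C \<and> (\<forall>i\<in>I. \<pi> i \<in> hom C p (d i)) \<and>
     (\<forall>z\<in>Obj C. \<forall>f. (\<forall>i\<in>I. f i \<in> hom C z (d i)) \<longrightarrow>
        (\<exists>!h. h \<in> hom C z p \<and> (\<forall>i\<in>I. Cmp C (\<pi> i) h = f i)))"

definition is_coproduct ::
  "('o, 'a, 'z) cat_scheme \<Rightarrow> 'i set \<Rightarrow> ('i \<Rightarrow> 'o) \<Rightarrow> 'o \<Rightarrow> ('i \<Rightarrow> 'a) \<Rightarrow> bool" where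
  "is_coproduct C I d s \<iota> \<longleftrightarrow>
     s \<in> Obj C \<and> (\<forall>i\<in>I. \<iota> i \<in> hom C (d i) s) \<and>
     (\<forall>z\<in>Obj C. \<forall>f. (\<forall>i\<in>I. f i \<in> hom C (d i) z) \<longrightarrow>
        (\<exists>!h. h \<in> hom C s z \<and> (\<forall>i\<in>I. Cmp C h (\<iota> i) = f i)))"

definition has_finite_products :: "('o, 'a, 'z) cat_scheme \<Rightarrow> bool" where
  "has_finite_products C \<longleftrightarrow>
     (\<forall>(n::nat) d. (\<forall>i<n. d i \<in> Obj C) \<longrightarrow> (\<exists>p \<pi>. is_product C {..<n} d p \<pi>))"

definition has_finite_coproducts :: "('o, 'a, 'z) cat_scheme \<Rightarrow> bool" where
  "has_finite_coproducts C \<longleftrightarrow>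
     (\<forall>(n::nat) d. (\<forall>i<n. d i \<in> Obj C) \<longrightarrow> (\<exists>s \<iota>. is_coproduct C {..<n} d s \<iota>))"

definition is_binary_product ::
  "('o, 'a, 'z) cat_scheme \<Rightarrow> 'o \<Rightarrow> 'o \<Rightarrow> 'o \<Rightarrow> 'a \<Rightarrow> 'a \<Rightarrow> bool" where
  "is_binary_product C a b p \<pi>1 \<pi>2 \<longleftrightarrow>
     p \<in> Obj C \<and> \<pi>1 \<in> hom C p a \<and> \<pi>2 \<in> hom C p b \<and>
     (\<forall>z\<in>Obj C. \<forall>f\<in>hom C z a. \<forall>g\<in>hom C z b.
        \<exists>!h. h \<in> hom C z p \<and> Cmp C \<pi>1 h = f \<and> Cmp C \<pi>2 h = g)"

text \<open>
  \<open>e\<close> is the exponential of \<open>c\<close> by \<open>b\<close>, with evaluation \<open>ev\<close> defined on the product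
  \<open>(p, \<pi>1, \<pi>2)\<close> of \<open>e\<close> and \<open>b\<close>. For a product \<open>(q, \<rho>1, \<rho>2)\<close> of \<open>z\<close> and \<open>b\<close>, the arrow
  \<open>k\<close> is the one induced by \<open>h\<close> and the identity of \<open>b\<close>.
\<close>

definition is_exponential ::
  "('o, 'a, 'z) cat_scheme \<Rightarrow> 'o \<Rightarrow> 'o \<Rightarrow> 'o \<Rightarrow> 'o \<Rightarrow> 'a \<Rightarrow> 'a \<Rightarrow> 'a \<Rightarrow> bool" where
  "is_exponential C b c e p \<pi>1 \<pi>2 ev \<longleftrightarrow>
     is_binary_product C e b p \<pi>1 \<pi>2 \<and> ev \<in> hom C p c \<and>
     (\<forall>z q \<rho>1 \<rho>2. is_binary_product C z b q \<rho>1 \<rho>2 \<longrightarrow>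
        (\<forall>g\<in>hom C q c. \<exists>!h. h \<in> hom C z e \<and>
           (\<exists>k\<in>hom C q p. Cmp C \<pi>1 k = Cmp C h \<rho>1 \<and> Cmp C \<pi>2 k = \<rho>2 \<and> Cmp C ev k = g)))"

definition cartesian_closed :: "('o, 'a, 'z) cat_scheme \<Rightarrow> bool" where
  "cartesian_closed C \<longleftrightarrow>
     category C \<and> has_finite_products C \<and>
     (\<forall>b\<in>Obj C. \<forall>c\<in>Obj C. \<exists>e p \<pi>1 \<pi>2 ev. is_exponential C b c e p \<pi>1 \<pi>2 ev)"


section \<open>Strict 2-categories\<close>

text \<open>
  The fields inherited from \<open>cat\<close> form the underlying 1-category, so the notions above apply
  to a 2-category directly. \<open>VCmp\<close> is vertical and \<open>HCmp\<close> horizontal composition of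
  2-cells, both in the order of function composition.
\<close>

record ('o, 'm, 'c) two_cat = "('o, 'm) cat" +
  Cell :: "'c set"
  Src :: "'c \<Rightarrow> 'm"
  Trg :: "'c \<Rightarrow> 'm"
  VId :: "'m \<Rightarrow> 'c"
  VCmp :: "'c \<Rightarrow> 'c \<Rightarrow> 'c"
  HCmp :: "'c \<Rightarrow> 'c \<Rightarrow> 'c"

definition cells :: "('o, 'm, 'c, 'z) two_cat_scheme \<Rightarrow> 'm \<Rightarrow> 'm \<Rightarrow> 'c set" where
  "cells W f g = {\<alpha> \<in> Cell W. Src W \<alpha> = f \<and> Trg W \<alpha> = g}"

definition hom_cat :: "('o, 'm, 'c, 'z) two_cat_scheme \<Rightarrow> 'o \<Rightarrow> 'o \<Rightarrow> ('m, 'c) cat" where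
  "hom_cat W X Y = \<lparr>Obj = hom W X Y,
     Arr = {\<alpha> \<in> Cell W. Src W \<alpha> \<in> hom W X Y \<and> Trg W \<alpha> \<in> hom W X Y},
     Dom = Src W, Cod = Trg W, Idt = VId W, Cmp = VCmp W\<rparr>"

locale two_category = category W
  for W :: "('o, 'm, 'c, 'z) two_cat_scheme" +
  assumes cell_parallel: "\<alpha> \<in> Cell W \<Longrightarrow> \<exists>X Y. Src W \<alpha> \<in> hom W X Y \<and> Trg W \<alpha> \<in> hom W X Y"
    and hom_category: "\<lbrakk>X \<in> Obj W; Y \<in> Obj W\<rbrakk> \<Longrightarrow> category (hom_cat W X Y)"
    and composition_functor: "\<lbrakk>X \<in> Obj W; Y \<in> Obj W; Z \<in> Obj W\<rbrakk> \<Longrightarrow>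
          is_functor (prod_cat (hom_cat W Y Z) (hom_cat W X Y)) (hom_cat W X Z)
            (\<lambda>(g, f). Cmp W g f) (\<lambda>(\<beta>, \<alpha>). HCmp W \<beta> \<alpha>)"
    and HCmp_id_left: "\<alpha> \<in> Arr (hom_cat W X Y) \<Longrightarrow> HCmp W (VId W (Idt W Y)) \<alpha> = \<alpha>"
    and HCmp_id_right: "\<alpha> \<in> Arr (hom_cat W X Y) \<Longrightarrow> HCmp W \<alpha> (VId W (Idt W X)) = \<alpha>"
    and HCmp_assoc: "\<lbrakk>\<alpha> \<in> Arr (hom_cat W X Y); \<beta> \<in> Arr (hom_cat W Y Z); \<gamma> \<in> Arr (hom_cat W Z V)\<rbrakk>
          \<Longrightarrow> HCmp W (HCmp W \<gamma> \<beta>) \<alpha> = HCmp W \<gamma> (HCmp W \<beta> \<alpha>)"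

definition adjunction ::
  "('o, 'm, 'c, 'z) two_cat_scheme \<Rightarrow> 'm \<Rightarrow> 'm \<Rightarrow> 'c \<Rightarrow> 'c \<Rightarrow> bool" where
  "adjunction W f g \<eta> \<epsilon> \<longleftrightarrow>
     f \<in> Arr W \<and> g \<in> hom W (Cod W f) (Dom W f) \<and>
     \<eta> \<in> cells W (Idt W (Dom W f)) (Cmp W g f) \<and>
     \<epsilon> \<in> cells W (Cmp W f g) (Idt W (Cod W f)) \<and>
     VCmp W (HCmp W \<epsilon> (VId W f)) (HCmp W (VId W f) \<eta>) = VId W f \<and>
     VCmp W (HCmp W (VId W g) \<epsilon>) (HCmp W \<eta> (VId W g)) = VId W g"

definition is_right_adjoint :: "('o, 'm, 'c, 'z) two_cat_scheme \<Rightarrow> 'm \<Rightarrow> 'm \<Rightarrow> bool" where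
  "is_right_adjoint W f g \<longleftrightarrow> (\<exists>\<eta> \<epsilon>. adjunction W f g \<eta> \<epsilon>)"

definition has_right_adjoint :: "('o, 'm, 'c, 'z) two_cat_scheme \<Rightarrow> 'm \<Rightarrow> bool" where
  "has_right_adjoint W f \<longleftrightarrow> (\<exists>g. is_right_adjoint W f g)"

definition has_left_adjoint :: "('o, 'm, 'c, 'z) two_cat_scheme \<Rightarrow> 'm \<Rightarrow> bool" where
  "has_left_adjoint W g \<longleftrightarrow> (\<exists>f. is_right_adjoint W f g)"


section \<open>Finite products in a 2-category\<close>

definition is_2terminal :: "('o, 'm, 'c, 'z) two_cat_scheme \<Rightarrow> 'o \<Rightarrow> bool" where
  "is_2terminal W T \<longleftrightarrow> T \<in> Obj W \<and>
     (\<forall>X\<in>Obj W. is_cat_iso (hom_cat W X T) unit_cat (\<lambda>_. ()) (\<lambda>_. ()))"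

definition is_2product ::
  "('o, 'm, 'c, 'z) two_cat_scheme \<Rightarrow> 'o \<Rightarrow> 'o \<Rightarrow> 'o \<Rightarrow> 'm \<Rightarrow> 'm \<Rightarrow> bool" where
  "is_2product W A B P p q \<longleftrightarrow>
     P \<in> Obj W \<and> p \<in> hom W P A \<and> q \<in> hom W P B \<and>
     (\<forall>X\<in>Obj W. is_cat_iso (hom_cat W X P) (prod_cat (hom_cat W X A) (hom_cat W X B))
        (\<lambda>f. (Cmp W p f, Cmp W q f))
        (\<lambda>\<alpha>. (HCmp W (VId W p) \<alpha>, HCmp W (VId W q) \<alpha>)))"

text \<open>A choice of a terminal object and of binary products with their projections.\<close>

record ('o, 'm) products =
  One :: 'o
  Prod :: "'o \<Rightarrow> 'o \<Rightarrow> 'o"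
  Pr1 :: "'o \<Rightarrow> 'o \<Rightarrow> 'm"
  Pr2 :: "'o \<Rightarrow> 'o \<Rightarrow> 'm"

definition finite_2products ::
  "('o, 'm, 'c, 'z) two_cat_scheme \<Rightarrow> ('o, 'm) products \<Rightarrow> bool" where
  "finite_2products W P \<longleftrightarrow> is_2terminal W (One P) \<and>
     (\<forall>A\<in>Obj W. \<forall>B\<in>Obj W. is_2product W A B (Prod P A B) (Pr1 P A B) (Pr2 P A B))"

definition bang :: "('o, 'm, 'c, 'z) two_cat_scheme \<Rightarrow> ('o, 'm) products \<Rightarrow> 'o \<Rightarrow> 'm" where
  "bang W P A = (THE f. f \<in> hom W A (One P))"

definition pairing :: "('o, 'm, 'c, 'z) two_cat_scheme \<Rightarrow> ('o, 'm) products \<Rightarrow> 'm \<Rightarrow> 'm \<Rightarrow> 'm" where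
  "pairing W P f g = (THE h. h \<in> hom W (Dom W f) (Prod P (Cod W f) (Cod W g)) \<and>
     Cmp W (Pr1 P (Cod W f) (Cod W g)) h = f \<and> Cmp W (Pr2 P (Cod W f) (Cod W g)) h = g)"

definition prod_map :: "('o, 'm, 'c, 'z) two_cat_scheme \<Rightarrow> ('o, 'm) products \<Rightarrow> 'm \<Rightarrow> 'm \<Rightarrow> 'm" where
  "prod_map W P f g = pairing W P
     (Cmp W f (Pr1 P (Dom W f) (Dom W g))) (Cmp W g (Pr2 P (Dom W f) (Dom W g)))"

definition diagonal :: "('o, 'm, 'c, 'z) two_cat_scheme \<Rightarrow> ('o, 'm) products \<Rightarrow> 'o \<Rightarrow> 'm" where
  "diagonal W P A = pairing W P (Idt W A) (Idt W A)"


section \<open>Notions of discreteness\<close>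

record ('x, 'y, 'o, 'm) discreteness =
  Base :: "('x, 'y) cat"
  FObj :: "'x \<Rightarrow> 'o"
  FArr :: "'y \<Rightarrow> 'm"
  UObj :: "'o \<Rightarrow> 'x"
  UArr :: "'m \<Rightarrow> 'y"
  Unit :: "'x \<Rightarrow> 'y"
  Counit :: "'o \<Rightarrow> 'm"

definition two_fully_faithful ::
  "('x, 'y, 'z) cat_scheme \<Rightarrow> ('o, 'm, 'c, 'w) two_cat_scheme \<Rightarrow> ('x \<Rightarrow> 'o) \<Rightarrow> ('y \<Rightarrow> 'm) \<Rightarrow> bool" where
  "two_fully_faithful C W Fo Fa \<longleftrightarrow>
     (\<forall>X\<in>Obj C. \<forall>Y\<in>Obj C.
        is_cat_iso (discrete_cat (hom C X Y)) (hom_cat W (Fo X) (Fo Y)) Fa (\<lambda>f. VId W (Fa f)))"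

definition notion_of_discreteness ::
  "('o, 'm, 'c, 'z) two_cat_scheme \<Rightarrow> ('x, 'y, 'o, 'm) discreteness \<Rightarrow> bool" where
  "notion_of_discreteness W D \<longleftrightarrow>
     category (Base D) \<and>
     is_functor (Base D) W (FObj D) (FArr D) \<and>
     two_fully_faithful (Base D) W (FObj D) (FArr D) \<and>
     functor_adjunction (Base D) W (FObj D) (FArr D) (UObj D) (UArr D) (Unit D) (Counit D) \<and>
     (\<forall>X\<in>Obj (Base D). is_iso (Base D) (Unit D X))"

definition discrete_objects :: "('x, 'y, 'o, 'm) discreteness \<Rightarrow> 'o set" where
  "discrete_objects D = FObj D ` Obj (Base D)"

definition underlying :: "('x, 'y, 'o, 'm) discreteness \<Rightarrow> 'o \<Rightarrow> 'o" where
  "underlying D A = FObj D (UObj D A)"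


section \<open>Internal structure on an object\<close>

definition has_internal_terminal ::
  "('o, 'm, 'c, 'z) two_cat_scheme \<Rightarrow> ('o, 'm) products \<Rightarrow> 'o \<Rightarrow> bool" where
  "has_internal_terminal W P A \<longleftrightarrow> has_right_adjoint W (bang W P A)"

definition has_internal_initial ::
  "('o, 'm, 'c, 'z) two_cat_scheme \<Rightarrow> ('o, 'm) products \<Rightarrow> 'o \<Rightarrow> bool" where
  "has_internal_initial W P A \<longleftrightarrow> has_left_adjoint W (bang W P A)"

definition has_internal_products ::
  "('o, 'm, 'c, 'z) two_cat_scheme \<Rightarrow> ('o, 'm) products \<Rightarrow> 'o \<Rightarrow> bool" where
  "has_internal_products W P A \<longleftrightarrow> has_right_adjoint W (diagonal W P A)"

definition has_internal_coproducts ::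
  "('o, 'm, 'c, 'z) two_cat_scheme \<Rightarrow> ('o, 'm) products \<Rightarrow> 'o \<Rightarrow> bool" where
  "has_internal_coproducts W P A \<longleftrightarrow> has_left_adjoint W (diagonal W P A)"

text \<open>
  The endomorphism of \<open>A \<times> |A|\<close> whose first component is \<open>m \<circ> (id \<times> \<epsilon>\<^sub>A)\<close> and whose second
  component is the projection to \<open>|A|\<close>, where \<open>m : A \<times> A \<rightarrow> A\<close>.
\<close>

definition closure_map ::
  "('o, 'm, 'c, 'z) two_cat_scheme \<Rightarrow> ('o, 'm) products \<Rightarrow> ('x, 'y, 'o, 'm) discreteness \<Rightarrow>
   'o \<Rightarrow> 'm \<Rightarrow> 'm" where
  "closure_map W P D A m = pairing W P
     (Cmp W m (prod_map W P (Idt W A) (Counit D A)))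
     (Pr2 P A (underlying D A))"

text \<open>
  The internal product \<open>m\<close> is determined only up to isomorphism; since isomorphic morphisms
  have the same right adjoints, the choice of \<open>m\<close> does not matter.
\<close>

definition internally_cartesian_closed ::
  "('o, 'm, 'c, 'z) two_cat_scheme \<Rightarrow> ('o, 'm) products \<Rightarrow> ('x, 'y, 'o, 'm) discreteness \<Rightarrow>
   'o \<Rightarrow> bool" where
  "internally_cartesian_closed W P D A \<longleftrightarrow>
     has_internal_terminal W P A \<and> has_internal_products W P A \<and>
     (\<exists>m. is_right_adjoint W (diagonal W P A) m \<and>
          has_right_adjoint W (closure_map W P D A m))"

definition internally_cocartesian ::
  "('o, 'm, 'c, 'z) two_cat_scheme \<Rightarrow> ('o, 'm) products \<Rightarrow> 'o \<Rightarrow> bool" where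
  "internally_cocartesian W P A \<longleftrightarrow>
     has_internal_initial W P A \<and> has_internal_coproducts W P A"

end

theory Submission
  imports Defs
begin

text \<open>
  Composition with an internal adjunction gives an ordinary adjunction between
  hom-categories. Since \<open>hom(X, 1)\<close> and \<open>hom(X, A \<times> A)\<close> are the unit category and the square of
  \<open>hom(X, A)\<close>, the adjoints of \<open>!\<close> and \<open>\<Delta>\<close> become terminal (initial) objects and binary products
  (coproducts) of \<open>hom(X, A)\<close>. For exponentials, a morphism \<open>b : X \<rightarrow> A\<close> from a discrete object
  factors through \<open>\<epsilon>\<^sub>A\<close>, and \<open>hom(X, |A|)\<close> has only identity arrows; so the
  adjunction on \<open>hom(X, A \<times> |A|) \<cong> hom(X, A) \<times> hom(X, |A|)\<close> restricts over each \<open>b\<close> to a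
  right adjoint of \<open>- \<times> b\<close>.
\<close>

section \<open>Functors and adjunctions of categories\<close>

text \<open>An exponential of c by b is contravariant in b, whereas a right adjoint on
  \<open>A \<times> A\<close> would depend covariantly on both arguments. Replacing the second
  factor by \<open>|A|\<close> leaves only identities in the variable b, and the clash of variance
  disappears. The price is that the right adjoint sends a pair (c, s) to some (e, t), and nothing in
  its type says that t is s. This is recovered from the counit at (c, s): its second component is an
  arrow from t to s, hence an identity.

  A second obstacle is that \<open>is_exponential\<close> tests against every product cone on z and
  b, while the adjunction only speaks of the products chosen by the adjoint of the diagonal. The two
  conditions have to be compared along the isomorphism of products.

  Functors are raw maps that are meaningful only on the carriers of their categories. Equations such
  as "this functor is the diagonal" are therefore assumed and proved on carriers only, never as
  equations of functions.\<close>

lemma homD: "f \<in> hom C x y \<Longrightarrow> f \<in> Arr C \<and> Dom C f = x \<and> Cod C f = y"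
  by (simp add: hom_def)

lemma hom_Arr: "f \<in> hom C x y \<Longrightarrow> f \<in> Arr C"
  by (simp add: hom_def)

lemma Arr_in_hom: "f \<in> Arr C \<Longrightarrow> f \<in> hom C (Dom C f) (Cod C f)"
  by (simp add: hom_def)

lemma (in category) hom_Obj: "f \<in> hom C x y \<Longrightarrow> x \<in> Obj C \<and> y \<in> Obj C"
  using Dom_in_Obj Cod_in_Obj by (auto simp: hom_def)

lemma is_functor_category:
  "is_functor C D Fo Fa \<Longrightarrow> category C" "is_functor C D Fo Fa \<Longrightarrow> category D"
  by (simp_all add: is_functor_def)

lemma is_functor_Obj: "is_functor C D Fo Fa \<Longrightarrow> x \<in> Obj C \<Longrightarrow> Fo x \<in> Obj D"
  by (simp add: is_functor_def)

lemma is_functor_hom: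
  "is_functor C D Fo Fa \<Longrightarrow> f \<in> hom C x y \<Longrightarrow> Fa f \<in> hom D (Fo x) (Fo y)"
  by (auto simp: is_functor_def hom_def)

lemma is_functor_Idt: "is_functor C D Fo Fa \<Longrightarrow> x \<in> Obj C \<Longrightarrow> Fa (Idt C x) = Idt D (Fo x)"
  by (simp add: is_functor_def)

lemma is_functor_Cmp:
  "is_functor C D Fo Fa \<Longrightarrow> f \<in> hom C x y \<Longrightarrow> g \<in> hom C y z \<Longrightarrow>
    Fa (Cmp C g f) = Cmp D (Fa g) (Fa f)"
  by (auto simp: is_functor_def hom_def)

lemma is_functorI:
  assumes "category C" "category D"
    and "\<And>x. x \<in> Obj C \<Longrightarrow> Fo x \<in> Obj D"
    and "\<And>f x y. f \<in> hom C x y \<Longrightarrow> Fa f \<in> hom D (Fo x) (Fo y)"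
    and "\<And>x. x \<in> Obj C \<Longrightarrow> Fa (Idt C x) = Idt D (Fo x)"
    and "\<And>f g x y z. f \<in> hom C x y \<Longrightarrow> g \<in> hom C y z \<Longrightarrow> Fa (Cmp C g f) = Cmp D (Fa g) (Fa f)"
  shows "is_functor C D Fo Fa"
  using assms by (auto simp: is_functor_def Arr_in_hom) (metis Arr_in_hom)

lemma is_functor_comp:
  assumes F: "is_functor C D Fo Fa" and G: "is_functor D E Go Ga"
  shows "is_functor C E (\<lambda>x. Go (Fo x)) (\<lambda>f. Ga (Fa f))"
  using is_functor_category[OF F] is_functor_category[OF G]
    is_functor_Obj[OF F] is_functor_Obj[OF G] is_functor_hom[OF F] is_functor_hom[OF G]
    is_functor_Idt[OF F] is_functor_Idt[OF G]
  by (intro is_functorI) (auto simp: is_functor_Cmp[OF F] is_functor_Cmp[OF G is_functor_hom[OF F] is_functor_hom[OF F]])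

lemma is_functor_id: "category C \<Longrightarrow> is_functor C C (\<lambda>x. x) (\<lambda>f. f)"
  by (intro is_functorI) auto

lemma natural_transformationD:
  assumes "natural_transformation C D Fo Fa Go Ga \<tau>"
  shows "is_functor C D Fo Fa" "is_functor C D Go Ga"
    and "x \<in> Obj C \<Longrightarrow> \<tau> x \<in> hom D (Fo x) (Go x)"
    and "f \<in> hom C x y \<Longrightarrow> Cmp D (\<tau> y) (Fa f) = Cmp D (Ga f) (\<tau> x)"
  using assms by (auto simp: natural_transformation_def hom_def)

lemma natural_transformationI:
  assumes "is_functor C D Fo Fa" "is_functor C D Go Ga"
    and "\<And>x. x \<in> Obj C \<Longrightarrow> \<tau> x \<in> hom D (Fo x) (Go x)"
    and "\<And>f x y. f \<in> hom C x y \<Longrightarrow> Cmp D (\<tau> y) (Fa f) = Cmp D (Ga f) (\<tau> x)"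
  shows "natural_transformation C D Fo Fa Go Ga \<tau>"
  using assms by (auto simp: natural_transformation_def Arr_in_hom)

lemma functor_adjunctionD:
  assumes "functor_adjunction C D Fo Fa Uo Ua \<eta> \<epsilon>"
  shows "is_functor C D Fo Fa" "is_functor D C Uo Ua"
    and "x \<in> Obj C \<Longrightarrow> \<eta> x \<in> hom C x (Uo (Fo x))"
    and "y \<in> Obj D \<Longrightarrow> \<epsilon> y \<in> hom D (Fo (Uo y)) y"
    and "f \<in> hom C x x' \<Longrightarrow> Cmp C (\<eta> x') f = Cmp C (Ua (Fa f)) (\<eta> x)"
    and "g \<in> hom D y y' \<Longrightarrow> Cmp D (\<epsilon> y') (Fa (Ua g)) = Cmp D g (\<epsilon> y)"
    and "x \<in> Obj C \<Longrightarrow> Cmp D (\<epsilon> (Fo x)) (Fa (\<eta> x)) = Idt D (Fo x)"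
    and "y \<in> Obj D \<Longrightarrow> Cmp C (Ua (\<epsilon> y)) (\<eta> (Uo y)) = Idt C (Uo y)"
  using assms unfolding functor_adjunction_def
  by (auto dest: natural_transformationD)

lemma functor_adjunctionI:
  assumes F: "is_functor C D Fo Fa" and U: "is_functor D C Uo Ua"
    and "\<And>x. x \<in> Obj C \<Longrightarrow> \<eta> x \<in> hom C x (Uo (Fo x))"
    and "\<And>y. y \<in> Obj D \<Longrightarrow> \<epsilon> y \<in> hom D (Fo (Uo y)) y"
    and "\<And>f x x'. f \<in> hom C x x' \<Longrightarrow> Cmp C (\<eta> x') f = Cmp C (Ua (Fa f)) (\<eta> x)"
    and "\<And>g y y'. g \<in> hom D y y' \<Longrightarrow> Cmp D (\<epsilon> y') (Fa (Ua g)) = Cmp D g (\<epsilon> y)"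
    and "\<And>x. x \<in> Obj C \<Longrightarrow> Cmp D (\<epsilon> (Fo x)) (Fa (\<eta> x)) = Idt D (Fo x)"
    and "\<And>y. y \<in> Obj D \<Longrightarrow> Cmp C (Ua (\<epsilon> y)) (\<eta> (Uo y)) = Idt C (Uo y)"
  shows "functor_adjunction C D Fo Fa Uo Ua \<eta> \<epsilon>"
  unfolding functor_adjunction_def
  using assms is_functor_comp[OF F U] is_functor_comp[OF U F]
    is_functor_id[OF is_functor_category(1)[OF F]] is_functor_id[OF is_functor_category(2)[OF F]]
  by (auto intro!: natural_transformationI)

text \<open>Transposition, the form in which adjunctions are used from here on: terminal objects,
  products, exponentials and the factorization through \<open>|A|\<close> are all instances of
  it.\<close>

lemma functor_adjunction_universal:
  assumes adj: "functor_adjunction C D Fo Fa Uo Ua \<eta> \<epsilon>"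
    and x: "x \<in> Obj C" and y: "y \<in> Obj D" and b: "b \<in> hom D (Fo x) y"
  shows "\<exists>!a. a \<in> hom C x (Uo y) \<and> Cmp D (\<epsilon> y) (Fa a) = b"
proof -
  note A = functor_adjunctionD[OF adj]
  interpret C: category C using A(1) by (rule is_functor_category)
  interpret D: category D using A(1) by (rule is_functor_category)
  note F = is_functor_hom[OF A(1)] and U = is_functor_hom[OF A(2)]
  have Fx: "Fo x \<in> Obj D" using A(1) x by (rule is_functor_Obj)
  have Uy: "Uo y \<in> Obj C" using A(2) y by (rule is_functor_Obj)
  show ?thesis
  proof (rule ex1I[where a = "Cmp C (Ua b) (\<eta> x)"])
    have "Cmp D (\<epsilon> y) (Fa (Cmp C (Ua b) (\<eta> x))) = Cmp D (\<epsilon> y) (Cmp D (Fa (Ua b)) (Fa (\<eta> x)))"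
      using is_functor_Cmp[OF A(1) A(3)[OF x] U[OF b]] by simp
    also have "\<dots> = Cmp D (Cmp D (\<epsilon> y) (Fa (Ua b))) (Fa (\<eta> x))"
      using D.Cmp_assoc[OF F[OF A(3)[OF x]] F[OF U[OF b]] A(4)[OF y]] by simp
    also have "\<dots> = Cmp D (Cmp D b (\<epsilon> (Fo x))) (Fa (\<eta> x))"
      using A(6)[OF b] by simp
    also have "\<dots> = Cmp D b (Idt D (Fo x))"
      using D.Cmp_assoc[OF F[OF A(3)[OF x]] A(4)[OF Fx] b] A(7)[OF x] by simp
    also have "\<dots> = b" using b by (rule D.Cmp_Idt_right)
    finally show "Cmp C (Ua b) (\<eta> x) \<in> hom C x (Uo y) \<and>
        Cmp D (\<epsilon> y) (Fa (Cmp C (Ua b) (\<eta> x))) = b"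
      using C.Cmp_in_hom[OF A(3)[OF x] U[OF b]] by simp
  next
    fix a assume "a \<in> hom C x (Uo y) \<and> Cmp D (\<epsilon> y) (Fa a) = b"
    then have a: "a \<in> hom C x (Uo y)" and ab: "b = Cmp D (\<epsilon> y) (Fa a)" by auto
    \<comment> \<open>Uniqueness: substituting b in the transpose
      \<open>Cmp C (Ua b) (\<eta> x)\<close> gives back a, by naturality of \<open>\<eta>\<close>
      and a triangle identity.\<close>
    have "Cmp C (Ua b) (\<eta> x) = Cmp C (Cmp C (Ua (\<epsilon> y)) (Ua (Fa a))) (\<eta> x)"
      unfolding ab using is_functor_Cmp[OF A(2) F[OF a] A(4)[OF y]] by simp
    also have "\<dots> = Cmp C (Ua (\<epsilon> y)) (Cmp C (\<eta> (Uo y)) a)"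
      using C.Cmp_assoc[OF A(3)[OF x] U[OF F[OF a]] U[OF A(4)[OF y]]] A(5)[OF a] by simp
    also have "\<dots> = Cmp C (Idt C (Uo y)) a"
      using C.Cmp_assoc[OF a A(3)[OF Uy] U[OF A(4)[OF y]]] A(8)[OF y] by simp
    also have "\<dots> = a" using a by (rule C.Cmp_Idt_left)
    finally show "a = Cmp C (Ua b) (\<eta> x)" by simp
  qed
qed

text \<open>Needed because an internal adjunction lands in hom(X, 1) or
  \<open>hom(X, A \<times> A)\<close>, which must still be followed by the isomorphism with the unit
  category or the product category.\<close>

lemma functor_adjunction_comp:
  assumes adj: "functor_adjunction C D Fo Fa Uo Ua \<eta> \<epsilon>"
    and adj': "functor_adjunction D E Fo' Fa' Uo' Ua' \<eta>' \<epsilon>'"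
  shows "functor_adjunction C E (\<lambda>x. Fo' (Fo x)) (\<lambda>f. Fa' (Fa f)) (\<lambda>y. Uo (Uo' y)) (\<lambda>g. Ua (Ua' g))
    (\<lambda>x. Cmp C (Ua (\<eta>' (Fo x))) (\<eta> x)) (\<lambda>y. Cmp E (\<epsilon>' y) (Fa' (\<epsilon> (Uo' y))))"
proof -
  note A = functor_adjunctionD[OF adj] and B = functor_adjunctionD[OF adj']
  interpret C: category C using A(1) by (rule is_functor_category)
  interpret D: category D using A(1) by (rule is_functor_category)
  interpret E: category E using B(1) by (rule is_functor_category)
  note F = is_functor_hom[OF A(1)] and U = is_functor_hom[OF A(2)]
    and F' = is_functor_hom[OF B(1)] and U' = is_functor_hom[OF B(2)]
  note Fo = is_functor_Obj[OF A(1)] and Uo = is_functor_Obj[OF A(2)]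
    and Fo' = is_functor_Obj[OF B(1)] and Uo' = is_functor_Obj[OF B(2)]
  note Fc = is_functor_Cmp[OF A(1)] and Uc = is_functor_Cmp[OF A(2)]
    and Fc' = is_functor_Cmp[OF B(1)] and Uc' = is_functor_Cmp[OF B(2)]
  show ?thesis
  proof (rule functor_adjunctionI)
    show "is_functor C E (\<lambda>x. Fo' (Fo x)) (\<lambda>f. Fa' (Fa f))" using A(1) B(1) by (rule is_functor_comp)
    show "is_functor E C (\<lambda>y. Uo (Uo' y)) (\<lambda>g. Ua (Ua' g))" using B(2) A(2) by (rule is_functor_comp)
  next
    fix x assume x: "x \<in> Obj C"
    show "Cmp C (Ua (\<eta>' (Fo x))) (\<eta> x) \<in> hom C x (Uo (Uo' (Fo' (Fo x))))"
      using C.Cmp_in_hom[OF A(3)[OF x] U[OF B(3)[OF Fo[OF x]]]] .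
  next
    fix y assume y: "y \<in> Obj E"
    show "Cmp E (\<epsilon>' y) (Fa' (\<epsilon> (Uo' y))) \<in> hom E (Fo' (Fo (Uo (Uo' y)))) y"
      using E.Cmp_in_hom[OF F'[OF A(4)[OF Uo'[OF y]]] B(4)[OF y]] .
  next
    fix f x x' assume f: "f \<in> hom C x x'"
    then have x: "x \<in> Obj C" and x': "x' \<in> Obj C" using C.hom_Obj by auto
    note h = B(3)[OF Fo[OF x]] and h' = B(3)[OF Fo[OF x']]
    have "Cmp C (Cmp C (Ua (\<eta>' (Fo x'))) (\<eta> x')) f = Cmp C (Ua (\<eta>' (Fo x'))) (Cmp C (Ua (Fa f)) (\<eta> x))"
      using C.Cmp_assoc[OF f A(3)[OF x'] U[OF h']] A(5)[OF f] by simp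
    also have "\<dots> = Cmp C (Ua (Cmp D (\<eta>' (Fo x')) (Fa f))) (\<eta> x)"
      using C.Cmp_assoc[OF A(3)[OF x] U[OF F[OF f]] U[OF h']] Uc[OF F[OF f] h'] by simp
    also have "\<dots> = Cmp C (Cmp C (Ua (Ua' (Fa' (Fa f)))) (Ua (\<eta>' (Fo x)))) (\<eta> x)"
      using B(5)[OF F[OF f]] Uc[OF h U'[OF F'[OF F[OF f]]]] by simp
    also have "\<dots> = Cmp C (Ua (Ua' (Fa' (Fa f)))) (Cmp C (Ua (\<eta>' (Fo x))) (\<eta> x))"
      using C.Cmp_assoc[OF A(3)[OF x] U[OF h] U[OF U'[OF F'[OF F[OF f]]]]] .
    finally show "Cmp C (Cmp C (Ua (\<eta>' (Fo x'))) (\<eta> x')) f =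
      Cmp C (Ua (Ua' (Fa' (Fa f)))) (Cmp C (Ua (\<eta>' (Fo x))) (\<eta> x))" .
  next
    fix g y y' assume g: "g \<in> hom E y y'"
    then have y: "y \<in> Obj E" and y': "y' \<in> Obj E" using E.hom_Obj by auto
    note h = A(4)[OF Uo'[OF y]] and h' = A(4)[OF Uo'[OF y']]
    have "Cmp E (Cmp E (\<epsilon>' y') (Fa' (\<epsilon> (Uo' y')))) (Fa' (Fa (Ua (Ua' g)))) =
        Cmp E (\<epsilon>' y') (Fa' (Cmp D (\<epsilon> (Uo' y')) (Fa (Ua (Ua' g)))))"
      using E.Cmp_assoc[OF F'[OF F[OF U[OF U'[OF g]]]] F'[OF h'] B(4)[OF y']]
        Fc'[OF F[OF U[OF U'[OF g]]] h'] by simp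
    also have "\<dots> = Cmp E (\<epsilon>' y') (Cmp E (Fa' (Ua' g)) (Fa' (\<epsilon> (Uo' y))))"
      using A(6)[OF U'[OF g]] Fc'[OF h U'[OF g]] by simp
    also have "\<dots> = Cmp E (Cmp E g (\<epsilon>' y)) (Fa' (\<epsilon> (Uo' y)))"
      using E.Cmp_assoc[OF F'[OF h] F'[OF U'[OF g]] B(4)[OF y']] B(6)[OF g] by simp
    also have "\<dots> = Cmp E g (Cmp E (\<epsilon>' y) (Fa' (\<epsilon> (Uo' y))))"
      using E.Cmp_assoc[OF F'[OF h] B(4)[OF y] g] .
    finally show "Cmp E (Cmp E (\<epsilon>' y') (Fa' (\<epsilon> (Uo' y')))) (Fa' (Fa (Ua (Ua' g)))) =
      Cmp E g (Cmp E (\<epsilon>' y) (Fa' (\<epsilon> (Uo' y))))" .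
  next
    fix x assume x: "x \<in> Obj C"
    let ?a = "Fo x" and ?b = "Fo' (Fo x)"
    have a: "?a \<in> Obj D" and b: "?b \<in> Obj E" using x Fo Fo' by auto
    note ha = B(3)[OF a] and hx = A(3)[OF x]
    note eb = B(4)[OF b]
    have ea: "\<epsilon> ?a \<in> hom D (Fo (Uo ?a)) ?a" using A(4)[OF a] .
    have ec: "\<epsilon> (Uo' ?b) \<in> hom D (Fo (Uo (Uo' ?b))) (Uo' ?b)" using A(4)[OF Uo'[OF b]] .
    \<comment> \<open>Inside \<open>Fa'\<close>, naturality of \<open>\<epsilon>\<close> at
      \<open>\<eta>' ?a\<close> and the first triangle identity cancel everything that comes from
      the first adjunction. What remains is the triangle identity of the second one.\<close>
    have "Cmp D (\<epsilon> (Uo' ?b)) (Fa (Cmp C (Ua (\<eta>' ?a)) (\<eta> x))) =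
        Cmp D (Cmp D (\<epsilon> (Uo' ?b)) (Fa (Ua (\<eta>' ?a)))) (Fa (\<eta> x))"
      using Fc[OF hx U[OF ha]] D.Cmp_assoc[OF F[OF hx] F[OF U[OF ha]] ec] by simp
    also have "\<dots> = Cmp D (\<eta>' ?a) (Cmp D (\<epsilon> ?a) (Fa (\<eta> x)))"
      using A(6)[OF ha] D.Cmp_assoc[OF F[OF hx] ea ha] by simp
    also have "\<dots> = \<eta>' ?a" using A(7)[OF x] D.Cmp_Idt_right[OF ha] by simp
    finally have 1: "Cmp D (\<epsilon> (Uo' ?b)) (Fa (Cmp C (Ua (\<eta>' ?a)) (\<eta> x))) = \<eta>' ?a" .
    have h: "Fa (Cmp C (Ua (\<eta>' ?a)) (\<eta> x)) \<in> hom D ?a (Fo (Uo (Uo' ?b)))"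
      using F[OF C.Cmp_in_hom[OF hx U[OF ha]]] .
    have "Cmp E (Cmp E (\<epsilon>' ?b) (Fa' (\<epsilon> (Uo' ?b)))) (Fa' (Fa (Cmp C (Ua (\<eta>' ?a)) (\<eta> x)))) =
        Cmp E (\<epsilon>' ?b) (Fa' (\<eta>' ?a))"
      using E.Cmp_assoc[OF F'[OF h] F'[OF ec] eb] Fc'[OF h ec] 1 by simp
    also have "\<dots> = Idt E ?b" using B(7)[OF a] .
    finally show "Cmp E (Cmp E (\<epsilon>' ?b) (Fa' (\<epsilon> (Uo' ?b)))) (Fa' (Fa (Cmp C (Ua (\<eta>' ?a)) (\<eta> x)))) = Idt E ?b" .
  next
    fix y assume y: "y \<in> Obj E"
    let ?a = "Uo' y" and ?b = "Uo (Uo' y)"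
    have a: "?a \<in> Obj D" and b: "?b \<in> Obj C" using y Uo Uo' by auto
    note ea = A(4)[OF a] and ey = B(4)[OF y]
    have ha: "\<eta>' ?a \<in> hom D ?a (Uo' (Fo' ?a))" using B(3)[OF a] .
    have hc: "\<eta>' (Fo ?b) \<in> hom D (Fo ?b) (Uo' (Fo' (Fo ?b)))" using B(3)[OF Fo[OF b]] .
    note hb = A(3)[OF b]
    \<comment> \<open>Dual cancellation inside \<open>Ua\<close>: here the second adjunction
      disappears and the triangle identity of the first remains.\<close>
    have "Cmp D (Ua' (Cmp E (\<epsilon>' y) (Fa' (\<epsilon> ?a)))) (\<eta>' (Fo ?b)) =
        Cmp D (Ua' (\<epsilon>' y)) (Cmp D (Ua' (Fa' (\<epsilon> ?a))) (\<eta>' (Fo ?b)))"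
      using Uc'[OF F'[OF ea] ey] D.Cmp_assoc[OF hc U'[OF F'[OF ea]] U'[OF ey]] by simp
    also have "\<dots> = Cmp D (Cmp D (Ua' (\<epsilon>' y)) (\<eta>' ?a)) (\<epsilon> ?a)"
      using B(5)[OF ea] D.Cmp_assoc[OF ea ha U'[OF ey]] by simp
    also have "\<dots> = \<epsilon> ?a" using B(8)[OF y] D.Cmp_Idt_left[OF ea] by simp
    finally have 1: "Cmp D (Ua' (Cmp E (\<epsilon>' y) (Fa' (\<epsilon> ?a)))) (\<eta>' (Fo ?b)) = \<epsilon> ?a" .
    have h: "Ua' (Cmp E (\<epsilon>' y) (Fa' (\<epsilon> ?a))) \<in> hom D (Uo' (Fo' (Fo ?b))) ?a"
      using U'[OF E.Cmp_in_hom[OF F'[OF ea] ey]] .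
    have "Cmp C (Ua (Ua' (Cmp E (\<epsilon>' y) (Fa' (\<epsilon> ?a))))) (Cmp C (Ua (\<eta>' (Fo ?b))) (\<eta> ?b)) =
        Cmp C (Ua (\<epsilon> ?a)) (\<eta> ?b)"
      using C.Cmp_assoc[OF hb U[OF hc] U[OF h]] Uc[OF hc h] 1 by simp
    also have "\<dots> = Idt C ?b" using A(8)[OF a] .
    finally show "Cmp C (Ua (Ua' (Cmp E (\<epsilon>' y) (Fa' (\<epsilon> ?a))))) (Cmp C (Ua (\<eta>' (Fo ?b))) (\<eta> ?b)) = Idt C ?b" .
  qed
qed

text \<open>\<open>is_cat_iso\<close> with the inverse as explicit parameters instead of under an
  existential, so that the inverse can appear as the adjoint functor in later statements.\<close>

definition inverse_functors ::
  "('o1, 'a1, 'z1) cat_scheme \<Rightarrow> ('o2, 'a2, 'z2) cat_scheme \<Rightarrow>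
   ('o1 \<Rightarrow> 'o2) \<Rightarrow> ('a1 \<Rightarrow> 'a2) \<Rightarrow> ('o2 \<Rightarrow> 'o1) \<Rightarrow> ('a2 \<Rightarrow> 'a1) \<Rightarrow> bool" where
  "inverse_functors C D Fo Fa Go Ga \<longleftrightarrow>
     is_functor C D Fo Fa \<and> is_functor D C Go Ga \<and>
     (\<forall>x\<in>Obj C. Go (Fo x) = x) \<and> (\<forall>f\<in>Arr C. Ga (Fa f) = f) \<and>
     (\<forall>y\<in>Obj D. Fo (Go y) = y) \<and> (\<forall>g\<in>Arr D. Fa (Ga g) = g)"

lemma is_cat_iso_iff: "is_cat_iso C D Fo Fa \<longleftrightarrow> (\<exists>Go Ga. inverse_functors C D Fo Fa Go Ga)"
  by (auto simp: is_cat_iso_def inverse_functors_def)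

lemma inverse_functors_sym:
  "inverse_functors C D Fo Fa Go Ga \<Longrightarrow> inverse_functors D C Go Ga Fo Fa"
  by (auto simp: inverse_functors_def)

text \<open>Turns the isomorphisms that define 2-products into adjunctions, so that they compose
  with the others. Together with \<open>inverse_functors_sym\<close> it makes either direction the
  left adjoint.\<close>

lemma inverse_functors_adjunction:
  assumes "inverse_functors C D Fo Fa Go Ga"
  shows "functor_adjunction C D Fo Fa Go Ga (Idt C) (Idt D)"
proof -
  have F: "is_functor C D Fo Fa" and G: "is_functor D C Go Ga"
    using assms by (auto simp: inverse_functors_def)
  interpret C: category C using F by (rule is_functor_category)
  interpret D: category D using F by (rule is_functor_category)
  have inv: "\<And>x. x \<in> Obj C \<Longrightarrow> Go (Fo x) = x" "\<And>f. f \<in> Arr C \<Longrightarrow> Ga (Fa f) = f"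
    "\<And>y. y \<in> Obj D \<Longrightarrow> Fo (Go y) = y" "\<And>g. g \<in> Arr D \<Longrightarrow> Fa (Ga g) = g"
    using assms by (auto simp: inverse_functors_def)
  show ?thesis
  proof (rule functor_adjunctionI[OF F G])
    fix f x x' assume "f \<in> hom C x x'"
    then show "Cmp C (Idt C x') f = Cmp C (Ga (Fa f)) (Idt C x)"
      by (simp add: C.Cmp_Idt_left C.Cmp_Idt_right inv homD)
  next
    fix f x x' assume "f \<in> hom D x x'"
    then show "Cmp D (Idt D x') (Fa (Ga f)) = Cmp D f (Idt D x)"
      by (simp add: D.Cmp_Idt_left D.Cmp_Idt_right inv homD)
  next
    fix x assume x: "x \<in> Obj C"
    show "Cmp D (Idt D (Fo x)) (Fa (Idt C x)) = Idt D (Fo x)"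
      using D.Cmp_Idt_left[OF is_functor_hom[OF F C.Idt_in_hom[OF x]]] is_functor_Idt[OF F x] by simp
  next
    fix x assume x: "x \<in> Obj D"
    show "Cmp C (Ga (Idt D x)) (Idt C (Go x)) = Idt C (Go x)"
      using C.Cmp_Idt_right[OF is_functor_hom[OF G D.Idt_in_hom[OF x]]] is_functor_Idt[OF G x] by simp
  qed (simp_all add: inv C.Idt_in_hom D.Idt_in_hom)
qed


section \<open>Opposite categories\<close>

definition op_cat :: "('o, 'a, 'z) cat_scheme \<Rightarrow> ('o, 'a) cat" where
  "op_cat C = \<lparr>Obj = Obj C, Arr = Arr C, Dom = Cod C, Cod = Dom C, Idt = Idt C,
     Cmp = (\<lambda>g f. Cmp C f g)\<rparr>"

lemma op_cat_simps [simp]: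
  "Obj (op_cat C) = Obj C" "Arr (op_cat C) = Arr C" "Dom (op_cat C) = Cod C" "Cod (op_cat C) = Dom C"
  "Idt (op_cat C) = Idt C" "Cmp (op_cat C) g f = Cmp C f g" "hom (op_cat C) x y = hom C y x"
  by (auto simp: op_cat_def hom_def)

lemma category_op_cat:
  assumes "category C" shows "category (op_cat C)"
proof -
  interpret category C by fact
  show ?thesis
    by unfold_locales
      (auto simp: Dom_in_Obj Cod_in_Obj Idt_in_hom Cmp_Idt_left Cmp_Idt_right Cmp_assoc intro: Cmp_in_hom)
qed

lemma is_functor_op_cat:
  assumes F: "is_functor C D Fo Fa" shows "is_functor (op_cat C) (op_cat D) Fo Fa"
  using is_functor_category[OF F] is_functor_Obj[OF F] is_functor_hom[OF F] is_functor_Idt[OF F]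
    is_functor_Cmp[OF F]
  by (intro is_functorI) (auto intro: category_op_cat)

lemma inverse_functors_op_cat:
  "inverse_functors C D Fo Fa Go Ga \<Longrightarrow> inverse_functors (op_cat C) (op_cat D) Fo Fa Go Ga"
  by (auto simp: inverse_functors_def is_functor_op_cat)

text \<open>Reversing arrows swaps the two functors, and unit with counit. A functor that has a left
  adjoint thus acquires a right adjoint, which reduces coproducts to the criterion for
  products.\<close>

lemma functor_adjunction_op_cat:
  assumes "functor_adjunction C D Fo Fa Uo Ua \<eta> \<epsilon>"
  shows "functor_adjunction (op_cat D) (op_cat C) Uo Ua Fo Fa \<epsilon> \<eta>"
  using functor_adjunctionD[OF assms]
  by (intro functor_adjunctionI) (auto intro: is_functor_op_cat)

text \<open>An equality of records, not just an isomorphism: the criterion for finite products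
  mentions \<open>unit_cat\<close> and \<open>prod_cat C C\<close> literally, and has to apply to
  opposite categories.\<close>

lemma op_cat_unit_cat: "op_cat unit_cat = unit_cat"
  by (simp add: op_cat_def unit_cat_def)

lemma op_cat_prod_cat: "op_cat (prod_cat C D) = prod_cat (op_cat C) (op_cat D)"
  by (auto simp: op_cat_def prod_cat_def fun_eq_iff)

lemma has_finite_coproducts_op_cat:
  "has_finite_products (op_cat C) \<Longrightarrow> has_finite_coproducts C"
  by (simp add: has_finite_products_def has_finite_coproducts_def is_product_def is_coproduct_def)


section \<open>Products and exponentials from adjoint functors\<close>

lemma has_finite_productsI:
  assumes "category C" and t: "t \<in> Obj C" and terminal: "\<And>z. z \<in> Obj C \<Longrightarrow> \<exists>!h. h \<in> hom C z t"
    and bin: "\<And>a b. a \<in> Obj C \<Longrightarrow> b \<in> Obj C \<Longrightarrow> \<exists>p \<pi>1 \<pi>2. is_binary_product C a b p \<pi>1 \<pi>2"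
  shows "has_finite_products C"
proof -
  interpret category C by fact
  have "\<exists>p \<pi>. is_product C {..<n} d p \<pi>" if "\<forall>i<n. d i \<in> Obj C" for n :: nat and d
    using that
  proof (induction n)
    case 0
    show ?case using t terminal unfolding is_product_def by (intro exI[of _ t]) simp
  next
    case (Suc n)
    then obtain p \<pi> where p: "is_product C {..<n} d p \<pi>" by auto
    then have p': "p \<in> Obj C \<and> (\<forall>i<n. \<pi> i \<in> hom C p (d i)) \<and>
        (\<forall>z\<in>Obj C. \<forall>f. (\<forall>i<n. f i \<in> hom C z (d i)) \<longrightarrow>
          (\<exists>!h. h \<in> hom C z p \<and> (\<forall>i<n. Cmp C (\<pi> i) h = f i)))"
      unfolding is_product_def Ball_def lessThan_iff .
    from p' have pO: "p \<in> Obj C" and pi: "\<And>i. i < n \<Longrightarrow> \<pi> i \<in> hom C p (d i)"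
      and puniv: "\<And>z f. z \<in> Obj C \<Longrightarrow> (\<And>i. i < n \<Longrightarrow> f i \<in> hom C z (d i)) \<Longrightarrow>
        \<exists>!h. h \<in> hom C z p \<and> (\<forall>i<n. Cmp C (\<pi> i) h = f i)"
      by blast+
    obtain q \<rho>1 \<rho>2 where q: "is_binary_product C p (d n) q \<rho>1 \<rho>2"
      using bin[OF pO, of "d n"] Suc.prems by auto
    then have qO: "q \<in> Obj C" and r1: "\<rho>1 \<in> hom C q p" and r2: "\<rho>2 \<in> hom C q (d n)"
      and quniv: "\<And>z f g. z \<in> Obj C \<Longrightarrow> f \<in> hom C z p \<Longrightarrow> g \<in> hom C z (d n) \<Longrightarrow>
        \<exists>!h. h \<in> hom C z q \<and> Cmp C \<rho>1 h = f \<and> Cmp C \<rho>2 h = g"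
      by (auto simp: is_binary_product_def)
    \<comment> \<open>The product of n + 1 factors is the product of the first n with the last one,
      so the old projections are precomposed with \<open>\<rho>1\<close>.\<close>
    let ?\<pi> = "\<lambda>i. if i < n then Cmp C (\<pi> i) \<rho>1 else \<rho>2"
    have "is_product C {..<Suc n} d q ?\<pi>"
      unfolding is_product_def
    proof (intro conjI ballI allI impI)
      show "q \<in> Obj C" by fact
    next
      fix i assume "i \<in> {..<Suc n}"
      then show "?\<pi> i \<in> hom C q (d i)"
        using Cmp_in_hom[OF r1 pi] r2 by (auto simp: less_Suc_eq)
    next
      fix z f assume z: "z \<in> Obj C" and f: "\<forall>i\<in>{..<Suc n}. f i \<in> hom C z (d i)"
      \<comment> \<open>Compatibility with n + 1 projections splits into a condition on the
        component in p and one on the last component. The two universal properties are then applied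
        in turn.\<close>
      have e: "(\<forall>i\<in>{..<Suc n}. Cmp C (?\<pi> i) h = f i) \<longleftrightarrow>
          (\<forall>i<n. Cmp C (\<pi> i) (Cmp C \<rho>1 h) = f i) \<and> Cmp C \<rho>2 h = f n" if "h \<in> hom C z q" for h
        using Cmp_assoc[OF that r1 pi] by (auto simp: less_Suc_eq)
      obtain k where k: "k \<in> hom C z p" "\<forall>i<n. Cmp C (\<pi> i) k = f i"
        and ku: "\<And>k'. k' \<in> hom C z p \<Longrightarrow> \<forall>i<n. Cmp C (\<pi> i) k' = f i \<Longrightarrow> k' = k"
        using puniv[of z f] z f unfolding Ex1_def by (metis lessThan_iff less_SucI)
      obtain h where h: "h \<in> hom C z q" "Cmp C \<rho>1 h = k" "Cmp C \<rho>2 h = f n"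
        and hu: "\<And>h'. h' \<in> hom C z q \<Longrightarrow> Cmp C \<rho>1 h' = k \<Longrightarrow> Cmp C \<rho>2 h' = f n \<Longrightarrow> h' = h"
        using quniv[OF z k(1), of "f n"] f unfolding Ex1_def by (metis lessThan_iff lessI)
      show "\<exists>!h. h \<in> hom C z q \<and> (\<forall>i\<in>{..<Suc n}. Cmp C (?\<pi> i) h = f i)"
      proof (rule ex1I[of _ h])
        show "h \<in> hom C z q \<and> (\<forall>i\<in>{..<Suc n}. Cmp C (?\<pi> i) h = f i)"
          using h k e by simp
      next
        fix h' assume h': "h' \<in> hom C z q \<and> (\<forall>i\<in>{..<Suc n}. Cmp C (?\<pi> i) h' = f i)"
        then have "(\<forall>i<n. Cmp C (\<pi> i) (Cmp C \<rho>1 h') = f i) \<and> Cmp C \<rho>2 h' = f n"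
          using e by blast
        moreover have "Cmp C \<rho>1 h' = k"
          using ku[of "Cmp C \<rho>1 h'"] h' Cmp_in_hom[OF _ r1] calculation by blast
        ultimately show "h' = h" using hu h' by blast
      qed
    qed
    then show ?case by blast
  qed
  then show ?thesis by (auto simp: has_finite_products_def)
qed

section \<open>Terminal objects and binary products from right adjoints\<close>

lemma hom_unit_cat: "hom unit_cat x y = {()}"
  by (auto simp: hom_def unit_cat_def)

lemma Obj_unit_cat: "Obj unit_cat = {()}"
  by (simp add: unit_cat_def)

text \<open>Over the unit category the equation satisfied by a transpose is vacuous, so
  transposition counts all arrows into \<open>Uo ()\<close>.\<close>

lemma terminal_of_adjunction:
  assumes adj: "functor_adjunction C unit_cat Fo Fa Uo Ua \<eta> \<epsilon>"
  shows "Uo () \<in> Obj C" and "z \<in> Obj C \<Longrightarrow> \<exists>!h. h \<in> hom C z (Uo ())"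
proof -
  show "Uo () \<in> Obj C"
    using is_functor_Obj[OF functor_adjunctionD(2)[OF adj]] by (simp add: Obj_unit_cat)
  show "\<exists>!h. h \<in> hom C z (Uo ())" if z: "z \<in> Obj C"
    using functor_adjunction_universal[OF adj z, of "()" "()"] by (simp add: hom_unit_cat Obj_unit_cat)
qed

lemma prod_cat_simps [simp]:
  "Obj (prod_cat C D) = Obj C \<times> Obj D"
  "hom (prod_cat C D) x y = hom C (fst x) (fst y) \<times> hom D (snd x) (snd y)"
  "Idt (prod_cat C D) x = (Idt C (fst x), Idt D (snd x))"
  "Cmp (prod_cat C D) g f = (Cmp C (fst g) (fst f), Cmp D (snd g) (snd f))"
  by (auto simp: prod_cat_def hom_def map_prod_def split: prod.splits)

text \<open>The counit at (a, b) is the pair of projections. The second conclusion is naturality of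
  the counit: it identifies \<open>Ua (f, g)\<close> as the product of the arrows f and g, which the
  exponentials need.\<close>

lemma product_of_adjunction:
  assumes adj: "functor_adjunction C (prod_cat C C) Fo Fa Uo Ua \<eta> \<epsilon>"
    and Fo: "\<forall>x\<in>Obj C. Fo x = (x, x)"
    and Fa: "\<forall>f\<in>Arr C. Fa f = (f, f)"
  shows "a \<in> Obj C \<Longrightarrow> b \<in> Obj C \<Longrightarrow>
      is_binary_product C a b (Uo (a, b)) (fst (\<epsilon> (a, b))) (snd (\<epsilon> (a, b)))"
    and "f \<in> hom C a a' \<Longrightarrow> g \<in> hom C b b' \<Longrightarrow>
      Cmp C (fst (\<epsilon> (a', b'))) (Ua (f, g)) = Cmp C f (fst (\<epsilon> (a, b))) \<and>
      Cmp C (snd (\<epsilon> (a', b'))) (Ua (f, g)) = Cmp C g (snd (\<epsilon> (a, b)))"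
proof -
  note A = functor_adjunctionD[OF adj]
  show "is_binary_product C a b (Uo (a, b)) (fst (\<epsilon> (a, b))) (snd (\<epsilon> (a, b)))"
    if a: "a \<in> Obj C" and b: "b \<in> Obj C"
    unfolding is_binary_product_def
  proof (intro conjI ballI)
    show U: "Uo (a, b) \<in> Obj C" using is_functor_Obj[OF A(2), of "(a, b)"] a b by simp
    have "\<epsilon> (a, b) \<in> hom (prod_cat C C) (Fo (Uo (a, b))) (a, b)" using A(4)[of "(a, b)"] a b by simp
    then show "fst (\<epsilon> (a, b)) \<in> hom C (Uo (a, b)) a" "snd (\<epsilon> (a, b)) \<in> hom C (Uo (a, b)) b"
      using Fo U by auto
    fix z f g assume z: "z \<in> Obj C" and f: "f \<in> hom C z a" and g: "g \<in> hom C z b"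
    have "\<exists>!h. h \<in> hom C z (Uo (a, b)) \<and> Cmp (prod_cat C C) (\<epsilon> (a, b)) (Fa h) = (f, g)"
      by (rule functor_adjunction_universal[OF adj z]) (use a b f g Fo z in auto)
    \<comment> \<open>As \<open>Fa h\<close> is (h, h), one equation in the product category amounts
      to the two projection equations.\<close>
    moreover have "h \<in> hom C z (Uo (a, b)) \<and> Cmp (prod_cat C C) (\<epsilon> (a, b)) (Fa h) = (f, g) \<longleftrightarrow>
      h \<in> hom C z (Uo (a, b)) \<and> Cmp C (fst (\<epsilon> (a, b))) h = f \<and> Cmp C (snd (\<epsilon> (a, b))) h = g" for h
      using Fa by (auto dest: homD)
    ultimately show "\<exists>!h. h \<in> hom C z (Uo (a, b)) \<and> Cmp C (fst (\<epsilon> (a, b))) h = f \<and>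
        Cmp C (snd (\<epsilon> (a, b))) h = g"
      by (simp only:)
  qed
  show "Cmp C (fst (\<epsilon> (a', b'))) (Ua (f, g)) = Cmp C f (fst (\<epsilon> (a, b))) \<and>
      Cmp C (snd (\<epsilon> (a', b'))) (Ua (f, g)) = Cmp C g (snd (\<epsilon> (a, b)))"
    if f: "f \<in> hom C a a'" and g: "g \<in> hom C b b'"
  proof -
    have fg: "(f, g) \<in> hom (prod_cat C C) (a, b) (a', b')" using f g by simp
    show ?thesis using A(6)[OF fg] Fa homD[OF is_functor_hom[OF A(2) fg]] by simp
  qed
qed

lemma has_finite_products_of_adjunctions:
  assumes "functor_adjunction C unit_cat To Ta Vo Va \<eta>' \<epsilon>'"
    and "functor_adjunction C (prod_cat C C) Fo Fa Uo Ua \<eta> \<epsilon>"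
    and "\<forall>x\<in>Obj C. Fo x = (x, x)"
    and "\<forall>f\<in>Arr C. Fa f = (f, f)"
  shows "has_finite_products C"
  using terminal_of_adjunction[OF assms(1)] product_of_adjunction(1)[OF assms(2-4)]
    is_functor_category(1)[OF functor_adjunctionD(1)[OF assms(1)]]
  by (intro has_finite_productsI[of C "Vo ()"]) blast+

section \<open>Exponentials from a right adjoint over a discrete parameter\<close>

text \<open>One chosen product of z and b for each z suffices: products are unique up to an
  isomorphism compatible with the projections, and the universal condition is transported along
  it.\<close>

lemma is_exponentialI:
  assumes "category C"
    and p: "is_binary_product C e b p \<pi>1 \<pi>2" and ev: "ev \<in> hom C p c"
    and prod: "\<And>z. z \<in> Obj C \<Longrightarrow> is_binary_product C z b (q z) (\<rho>1 z) (\<rho>2 z)"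
    and univ: "\<And>z g. z \<in> Obj C \<Longrightarrow> g \<in> hom C (q z) c \<Longrightarrow> \<exists>!h. h \<in> hom C z e \<and>
      (\<exists>k\<in>hom C (q z) p. Cmp C \<pi>1 k = Cmp C h (\<rho>1 z) \<and> Cmp C \<pi>2 k = \<rho>2 z \<and> Cmp C ev k = g)"
  shows "is_exponential C b c e p \<pi>1 \<pi>2 ev"
  unfolding is_exponential_def
proof (intro conjI allI impI ballI p ev)
  interpret category C by fact
  fix z r \<sigma>1 \<sigma>2 g
  assume r: "is_binary_product C z b r \<sigma>1 \<sigma>2" and g: "g \<in> hom C r c"
  have z: "z \<in> Obj C" using r hom_Obj by (auto simp: is_binary_product_def)
  have pp: "\<pi>1 \<in> hom C p e" "\<pi>2 \<in> hom C p b" using p by (auto simp: is_binary_product_def)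
  have rr: "r \<in> Obj C" "\<sigma>1 \<in> hom C r z" "\<sigma>2 \<in> hom C r b"
    and rx: "\<And>x f g. x \<in> Obj C \<Longrightarrow> f \<in> hom C x z \<Longrightarrow> g \<in> hom C x b \<Longrightarrow>
      \<exists>!h. h \<in> hom C x r \<and> Cmp C \<sigma>1 h = f \<and> Cmp C \<sigma>2 h = g"
    using r by (auto simp: is_binary_product_def)
  have qq: "q z \<in> Obj C" "\<rho>1 z \<in> hom C (q z) z" "\<rho>2 z \<in> hom C (q z) b"
    and qx: "\<And>x f g. x \<in> Obj C \<Longrightarrow> f \<in> hom C x z \<Longrightarrow> g \<in> hom C x b \<Longrightarrow>
      \<exists>!h. h \<in> hom C x (q z) \<and> Cmp C (\<rho>1 z) h = f \<and> Cmp C (\<rho>2 z) h = g"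
    using prod[OF z] by (auto simp: is_binary_product_def)
  obtain i where i: "i \<in> hom C (q z) r" "Cmp C \<sigma>1 i = \<rho>1 z" "Cmp C \<sigma>2 i = \<rho>2 z"
    using rx qq by meson
  obtain j where j: "j \<in> hom C r (q z)" "Cmp C (\<rho>1 z) j = \<sigma>1" "Cmp C (\<rho>2 z) j = \<sigma>2"
    using qx rr by meson
  \<comment> \<open>Both sides have the same projections, so they agree by uniqueness of induced
    arrows.\<close>
  have ij: "Cmp C i j = Idt C r"
  proof -
    have "Cmp C \<sigma>1 (Cmp C i j) = \<sigma>1" "Cmp C \<sigma>2 (Cmp C i j) = \<sigma>2"
      using Cmp_assoc[OF j(1) i(1) rr(2)] Cmp_assoc[OF j(1) i(1) rr(3)] i j by simp_all
    moreover have "Cmp C \<sigma>1 (Idt C r) = \<sigma>1" "Cmp C \<sigma>2 (Idt C r) = \<sigma>2"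
      using Cmp_Idt_right rr by auto
    ultimately show ?thesis
      using rx[OF rr] Cmp_in_hom[OF j(1) i(1)] Idt_in_hom[OF rr(1)] by blast
  qed
  have ji: "Cmp C j i = Idt C (q z)"
  proof -
    have "Cmp C (\<rho>1 z) (Cmp C j i) = \<rho>1 z" "Cmp C (\<rho>2 z) (Cmp C j i) = \<rho>2 z"
      using Cmp_assoc[OF i(1) j(1) qq(2)] Cmp_assoc[OF i(1) j(1) qq(3)] i j by simp_all
    moreover have "Cmp C (\<rho>1 z) (Idt C (q z)) = \<rho>1 z" "Cmp C (\<rho>2 z) (Idt C (q z)) = \<rho>2 z"
      using Cmp_Idt_right qq by auto
    ultimately show ?thesis
      using qx[OF qq] Cmp_in_hom[OF i(1) j(1)] Idt_in_hom[OF qq(1)] by blast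
  qed
  have gi: "Cmp C g i \<in> hom C (q z) c" using i(1) g by (rule Cmp_in_hom)
  have gij: "Cmp C (Cmp C g i) j = g" using Cmp_assoc[OF j(1) i(1) g] ij Cmp_Idt_right[OF g] by simp
  \<comment> \<open>For fixed h, precomposition with i and with j carries witnesses k from one
    condition to the other.\<close>
  have eq: "(\<exists>k\<in>hom C r p. Cmp C \<pi>1 k = Cmp C h \<sigma>1 \<and> Cmp C \<pi>2 k = \<sigma>2 \<and> Cmp C ev k = g) \<longleftrightarrow>
    (\<exists>k\<in>hom C (q z) p. Cmp C \<pi>1 k = Cmp C h (\<rho>1 z) \<and> Cmp C \<pi>2 k = \<rho>2 z \<and> Cmp C ev k = Cmp C g i)"
    (is "?L \<longleftrightarrow> ?R") if h: "h \<in> hom C z e" for h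
  proof
    assume ?L
    then obtain k where k: "k \<in> hom C r p" "Cmp C \<pi>1 k = Cmp C h \<sigma>1" "Cmp C \<pi>2 k = \<sigma>2" "Cmp C ev k = g"
      by blast
    show ?R
      using Cmp_assoc[OF i(1) k(1) pp(1)] Cmp_assoc[OF i(1) k(1) pp(2)] Cmp_assoc[OF i(1) k(1) ev]
        Cmp_assoc[OF i(1) rr(2) h] Cmp_in_hom[OF i(1) k(1)] k(2-4) i(2,3)
      by (intro bexI[of _ "Cmp C k i"]) simp_all
  next
    assume ?R
    then obtain k where k: "k \<in> hom C (q z) p" "Cmp C \<pi>1 k = Cmp C h (\<rho>1 z)" "Cmp C \<pi>2 k = \<rho>2 z"
      "Cmp C ev k = Cmp C g i"
      by blast
    show ?L
      using Cmp_assoc[OF j(1) k(1) pp(1)] Cmp_assoc[OF j(1) k(1) pp(2)] Cmp_assoc[OF j(1) k(1) ev]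
        Cmp_assoc[OF j(1) qq(2) h] Cmp_in_hom[OF j(1) k(1)] k(2-4) j(2,3) gij
      by (intro bexI[of _ "Cmp C k j"]) simp_all
  qed
  show "\<exists>!h. h \<in> hom C z e \<and>
      (\<exists>k\<in>hom C r p. Cmp C \<pi>1 k = Cmp C h \<sigma>1 \<and> Cmp C \<pi>2 k = \<sigma>2 \<and> Cmp C ev k = g)"
    using univ[OF z gi] by (simp only: eq cong: conj_cong)
qed

text \<open>On objects, \<open>Ko\<close> is (a, s) mapped to
  \<open>(a \<times> \<Phi> s, s)\<close>. Since S has only identities, arrows (z, s) to (e, s) are
  just arrows h from z to e, and transposition over the fixed s says that h corresponds to
  \<open>ev \<circ> (h \<times> id)\<close>. Giving \<open>Ka\<close> only on arrows with identity
  second component determines it on all arrows.\<close>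

lemma exponential_of_adjunctions:
  assumes adj: "functor_adjunction C (prod_cat C C) Fo Fa Uo Ua \<eta> \<epsilon>"
    and Fo: "\<forall>x\<in>Obj C. Fo x = (x, x)"
    and Fa: "\<forall>f\<in>Arr C. Fa f = (f, f)"
    and adj': "functor_adjunction (prod_cat C S) (prod_cat C S) Ko Ka Ro Ra \<eta>' \<epsilon>'"
    and Ko: "\<And>a s. a \<in> Obj C \<Longrightarrow> s \<in> Obj S \<Longrightarrow> Ko (a, s) = (Uo (a, \<Phi> s), s)"
    and Ka: "\<And>f a a' s. f \<in> hom C a a' \<Longrightarrow> s \<in> Obj S \<Longrightarrow>
      Ka (f, Idt S s) = (Ua (f, Idt C (\<Phi> s)), Idt S s)"
    and \<Phi>: "\<And>s. s \<in> Obj S \<Longrightarrow> \<Phi> s \<in> Obj C"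
    and S: "category S" "\<And>s t \<sigma>. \<sigma> \<in> hom S s t \<Longrightarrow> s = t \<and> \<sigma> = Idt S s"
    and s: "s \<in> Obj S" and c: "c \<in> Obj C"
  shows "\<exists>e p \<pi>1 \<pi>2 ev. is_exponential C (\<Phi> s) c e p \<pi>1 \<pi>2 ev"
proof -
  note A = functor_adjunctionD[OF adj] and B = functor_adjunctionD[OF adj']
  note prod = product_of_adjunction[OF adj Fo Fa]
  interpret C: category C using A(1) by (rule is_functor_category)
  interpret S: category S by (rule S(1))
  let ?b = "\<Phi> s" and ?y = "(c, s)"
  have b: "?b \<in> Obj C" and y: "?y \<in> Obj (prod_cat C S)" using \<Phi> s c by auto
  obtain e t where et: "Ro ?y = (e, t)" by fastforce
  have "(e, t) \<in> Obj (prod_cat C S)" using is_functor_Obj[OF B(2) y] et by simp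
  then have e: "e \<in> Obj C" and t: "t \<in> Obj S" by auto
  \<comment> \<open>The second component of the counit is an arrow from t to s in S, which forces t
    = s; its first component then has the type of an evaluation.\<close>
  have "\<epsilon>' ?y \<in> hom (prod_cat C S) (Uo (e, \<Phi> t), t) (c, s)" using B(4)[OF y] et Ko[OF e t] by simp
  then have ts: "t = s" and ev: "fst (\<epsilon>' ?y) \<in> hom C (Uo (e, ?b)) c" and sy: "snd (\<epsilon>' ?y) = Idt S s"
    using S(2)[of "snd (\<epsilon>' ?y)" t s] by auto
  have II: "Cmp S (Idt S s) (Idt S s) = Idt S s" using S.Cmp_Idt_left S.Idt_in_hom[OF s] by blast
  let ?ev = "fst (\<epsilon>' ?y)"
  let ?p1 = "\<lambda>z. fst (\<epsilon> (z, ?b))" and ?p2 = "\<lambda>z. snd (\<epsilon> (z, ?b))"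
  have "is_exponential C ?b c e (Uo (e, ?b)) (?p1 e) (?p2 e) ?ev"
  proof (rule is_exponentialI[where q = "\<lambda>z. Uo (z, ?b)" and ?\<rho>1.0 = ?p1 and ?\<rho>2.0 = ?p2])
    show "category C" by unfold_locales
    show pe: "is_binary_product C e ?b (Uo (e, ?b)) (?p1 e) (?p2 e)" using prod(1) e b by blast
    show "?ev \<in> hom C (Uo (e, ?b)) c" by (rule ev)
    fix z assume z: "z \<in> Obj C"
    show pz: "is_binary_product C z ?b (Uo (z, ?b)) (?p1 z) (?p2 z)" using prod(1) z b by blast
    fix g assume g: "g \<in> hom C (Uo (z, ?b)) c"
    have "\<exists>!a. a \<in> hom (prod_cat C S) (z, s) (e, s) \<and> Cmp (prod_cat C S) (\<epsilon>' ?y) (Ka a) = (g, Idt S s)"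
      using functor_adjunction_universal[OF adj', of "(z, s)" ?y "(g, Idt S s)"]
        z s y g et ts Ko[OF z s] S.Idt_in_hom[OF s] by simp
    then obtain a where a: "a \<in> hom (prod_cat C S) (z, s) (e, s)"
      "Cmp (prod_cat C S) (\<epsilon>' ?y) (Ka a) = (g, Idt S s)"
      and au: "\<And>a'. a' \<in> hom (prod_cat C S) (z, s) (e, s) \<Longrightarrow>
        Cmp (prod_cat C S) (\<epsilon>' ?y) (Ka a') = (g, Idt S s) \<Longrightarrow> a' = a"
      by blast
    obtain h where ah: "a = (h, Idt S s)" and h: "h \<in> hom C z e"
      using a(1) S(2) by (cases a) auto
    have comp: "Cmp (prod_cat C S) (\<epsilon>' ?y) (Ka (h', Idt S s)) = (Cmp C ?ev (Ua (h', Idt C ?b)), Idt S s)"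
      if "h' \<in> hom C z e" for h'
      using Ka[OF that s] sy II by simp
    \<comment> \<open>The only k with the prescribed projections is \<open>h' \<times> id\<close>,
      so the existential reduces to a single equation about \<open>?ev\<close>.\<close>
    have ex_iff: "(\<exists>k\<in>hom C (Uo (z, ?b)) (Uo (e, ?b)).
        Cmp C (?p1 e) k = Cmp C h' (?p1 z) \<and> Cmp C (?p2 e) k = ?p2 z \<and> Cmp C ?ev k = g) \<longleftrightarrow>
        Cmp C ?ev (Ua (h', Idt C ?b)) = g" if h': "h' \<in> hom C z e" for h'
    proof -
      let ?k = "Ua (h', Idt C ?b)"
      have p1: "?p1 z \<in> hom C (Uo (z, ?b)) z" and p2: "?p2 z \<in> hom C (Uo (z, ?b)) ?b"
        and U: "Uo (z, ?b) \<in> Obj C"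
        using pz by (auto simp: is_binary_product_def)
      have k: "?k \<in> hom C (Uo (z, ?b)) (Uo (e, ?b))"
        using is_functor_hom[OF A(2), of "(h', Idt C ?b)" "(z, ?b)" "(e, ?b)"] h' C.Idt_in_hom[OF b]
        by simp
      have n: "Cmp C (?p1 e) ?k = Cmp C h' (?p1 z)" "Cmp C (?p2 e) ?k = ?p2 z"
        using prod(2)[OF h' C.Idt_in_hom[OF b]] C.Cmp_Idt_left[OF p2] by auto
      have "k = ?k" if "k \<in> hom C (Uo (z, ?b)) (Uo (e, ?b))"
        "Cmp C (?p1 e) k = Cmp C h' (?p1 z)" "Cmp C (?p2 e) k = ?p2 z" for k
      proof -
        have "\<exists>!k. k \<in> hom C (Uo (z, ?b)) (Uo (e, ?b)) \<and>
            Cmp C (?p1 e) k = Cmp C h' (?p1 z) \<and> Cmp C (?p2 e) k = ?p2 z"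
          using pe U C.Cmp_in_hom[OF p1 h'] p2 unfolding is_binary_product_def by blast
        then show ?thesis using that k n by blast
      qed
      then show ?thesis using k n by blast
    qed
    show "\<exists>!h. h \<in> hom C z e \<and> (\<exists>k\<in>hom C (Uo (z, ?b)) (Uo (e, ?b)).
        Cmp C (?p1 e) k = Cmp C h (?p1 z) \<and> Cmp C (?p2 e) k = ?p2 z \<and> Cmp C ?ev k = g)"
    proof (rule ex1I[of _ h])
      show "h \<in> hom C z e \<and> (\<exists>k\<in>hom C (Uo (z, ?b)) (Uo (e, ?b)).
          Cmp C (?p1 e) k = Cmp C h (?p1 z) \<and> Cmp C (?p2 e) k = ?p2 z \<and> Cmp C ?ev k = g)"
        using ex_iff[OF h] comp[OF h] h a(2) unfolding ah by simp
    next
      fix h' assume *: "h' \<in> hom C z e \<and> (\<exists>k\<in>hom C (Uo (z, ?b)) (Uo (e, ?b)).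
          Cmp C (?p1 e) k = Cmp C h' (?p1 z) \<and> Cmp C (?p2 e) k = ?p2 z \<and> Cmp C ?ev k = g)"
      then have h': "h' \<in> hom C z e" by blast
      then have "Cmp C ?ev (Ua (h', Idt C ?b)) = g" using * ex_iff by blast
      then have "(h', Idt S s) = a"
        using au[of "(h', Idt S s)"] h' S.Idt_in_hom[OF s] comp[OF h'] by simp
      then show "h' = h" using ah by simp
    qed
  qed
  then show ?thesis by blast
qed


section \<open>Hom-categories of a 2-category\<close>

lemma hom_cat_simps [simp]:
  "Obj (hom_cat W X Y) = hom W X Y" "Idt (hom_cat W X Y) = VId W" "Cmp (hom_cat W X Y) = VCmp W"
  "Dom (hom_cat W X Y) = Src W" "Cod (hom_cat W X Y) = Trg W"
  by (simp_all add: hom_cat_def)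

lemma hom_hom_cat:
  "\<alpha> \<in> hom (hom_cat W X Y) f g \<longleftrightarrow> \<alpha> \<in> cells W f g \<and> f \<in> hom W X Y \<and> g \<in> hom W X Y"
  by (auto simp: hom_def hom_cat_def cells_def)

section \<open>Whiskering, and the action of hom(X, -) on adjunctions\<close>

context two_category
begin

lemma HCmp_in_hom:
  assumes a: "\<alpha> \<in> hom (hom_cat W X Y) f f'" and b: "\<beta> \<in> hom (hom_cat W Y Z) g g'"
  shows "HCmp W \<beta> \<alpha> \<in> hom (hom_cat W X Z) (Cmp W g f) (Cmp W g' f')"
proof -
  have "X \<in> Obj W" "Y \<in> Obj W" "Z \<in> Obj W" using a b hom_Obj by (auto simp: hom_hom_cat)
  from is_functor_hom[OF composition_functor[OF this], of "(\<beta>, \<alpha>)" "(g, f)" "(g', f')"]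
  show ?thesis using a b by simp
qed

text \<open>Preservation of composition by the functor of
  \<open>composition_functor\<close>.\<close>

lemma interchange:
  assumes a: "\<alpha> \<in> hom (hom_cat W X Y) f f'" "\<alpha>' \<in> hom (hom_cat W X Y) f' f''"
    and b: "\<beta> \<in> hom (hom_cat W Y Z) g g'" "\<beta>' \<in> hom (hom_cat W Y Z) g' g''"
  shows "HCmp W (VCmp W \<beta>' \<beta>) (VCmp W \<alpha>' \<alpha>) = VCmp W (HCmp W \<beta>' \<alpha>') (HCmp W \<beta> \<alpha>)"
proof -
  have "X \<in> Obj W" "Y \<in> Obj W" "Z \<in> Obj W" using a b hom_Obj by (auto simp: hom_hom_cat)
  from is_functor_Cmp[OF composition_functor[OF this], of "(\<beta>, \<alpha>)" "(g, f)" "(g', f')" "(\<beta>', \<alpha>')" "(g'', f'')"]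
  show ?thesis using a b by simp
qed

lemma HCmp_VId:
  assumes f: "f \<in> hom W X Y" and g: "g \<in> hom W Y Z"
  shows "HCmp W (VId W g) (VId W f) = VId W (Cmp W g f)"
proof -
  have "X \<in> Obj W" "Y \<in> Obj W" "Z \<in> Obj W" using f g hom_Obj by auto
  from is_functor_Idt[OF composition_functor[OF this], of "(g, f)"]
  show ?thesis using f g by simp
qed

lemma hom_cat_category: "f \<in> hom W X Y \<Longrightarrow> category (hom_cat W X Y)"
  using hom_Obj hom_category by blast

lemma VId_in_hom: "f \<in> hom W X Y \<Longrightarrow> VId W f \<in> hom (hom_cat W X Y) f f"
  using category.Idt_in_hom[OF hom_cat_category, of f X Y f] by simp

lemma VCmp_VId:
  assumes "\<alpha> \<in> hom (hom_cat W X Y) f g"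
  shows "VCmp W (VId W g) \<alpha> = \<alpha>" "VCmp W \<alpha> (VId W f) = \<alpha>"
proof -
  have "category (hom_cat W X Y)" using assms hom_cat_category by (auto simp: hom_hom_cat)
  from category.Cmp_Idt_left[OF this assms] category.Cmp_Idt_right[OF this assms]
  show "VCmp W (VId W g) \<alpha> = \<alpha>" "VCmp W \<alpha> (VId W f) = \<alpha>" by simp_all
qed

lemma HCmp_VId_Idt:
  "\<alpha> \<in> hom (hom_cat W X Y) f g \<Longrightarrow> HCmp W (VId W (Idt W Y)) \<alpha> = \<alpha>"
  by (rule HCmp_id_left) (rule hom_Arr)

lemma HCmp_assoc':
  assumes "\<alpha> \<in> hom (hom_cat W X Y) f f'" "\<beta> \<in> hom (hom_cat W Y Z) g g'" "\<gamma> \<in> hom (hom_cat W Z V) h h'"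
  shows "HCmp W (HCmp W \<gamma> \<beta>) \<alpha> = HCmp W \<gamma> (HCmp W \<beta> \<alpha>)"
  using assms[THEN hom_Arr] by (rule HCmp_assoc)

lemma HCmp_VId_VId:
  assumes f: "f \<in> hom W Y Z" and g: "g \<in> hom W Z V" and a: "\<alpha> \<in> hom (hom_cat W X Y) a a'"
  shows "HCmp W (VId W g) (HCmp W (VId W f) \<alpha>) = HCmp W (VId W (Cmp W g f)) \<alpha>"
  using HCmp_assoc'[OF a VId_in_hom[OF f] VId_in_hom[OF g]] HCmp_VId[OF f g] by simp

lemma postcomp_functor:
  assumes f: "f \<in> hom W A B" and X: "X \<in> Obj W"
  shows "is_functor (hom_cat W X A) (hom_cat W X B) (Cmp W f) (HCmp W (VId W f))"
proof (rule is_functorI)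
  have "A \<in> Obj W" "B \<in> Obj W" using f hom_Obj by auto
  then show "category (hom_cat W X A)" "category (hom_cat W X B)" using X hom_category by auto
  show "Cmp W f x \<in> Obj (hom_cat W X B)" if "x \<in> Obj (hom_cat W X A)" for x
    using that f Cmp_in_hom by simp
  show "HCmp W (VId W f) \<alpha> \<in> hom (hom_cat W X B) (Cmp W f x) (Cmp W f y)"
    if "\<alpha> \<in> hom (hom_cat W X A) x y" for \<alpha> x y
    using that VId_in_hom[OF f] by (rule HCmp_in_hom)
  show "HCmp W (VId W f) (Idt (hom_cat W X A) x) = Idt (hom_cat W X B) (Cmp W f x)"
    if "x \<in> Obj (hom_cat W X A)" for x
    using that HCmp_VId f by simp
  show "HCmp W (VId W f) (Cmp (hom_cat W X A) \<beta> \<alpha>) =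
      Cmp (hom_cat W X B) (HCmp W (VId W f) \<beta>) (HCmp W (VId W f) \<alpha>)"
    if "\<alpha> \<in> hom (hom_cat W X A) x y" "\<beta> \<in> hom (hom_cat W X A) y z" for \<alpha> \<beta> x y z
    \<comment> \<open>\<open>VId W f\<close> is replaced by its vertical composite with itself,
      which brings the goal into the shape of the interchange law.\<close>
    using interchange[OF that VId_in_hom[OF f] VId_in_hom[OF f]] VCmp_VId(1)[OF VId_in_hom[OF f]] by simp
qed

text \<open>hom(X, -) is a 2-functor to categories, and 2-functors preserve adjunctions. Unit and
  counit at a morphism are the internal ones whiskered with it, so the triangle identities are the
  internal ones whiskered.\<close>

lemma postcomp_adjunction:
  assumes adj: "adjunction W f g \<eta> \<epsilon>" and f: "f \<in> hom W A B" and X: "X \<in> Obj W"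
  shows "functor_adjunction (hom_cat W X A) (hom_cat W X B)
    (Cmp W f) (HCmp W (VId W f)) (Cmp W g) (HCmp W (VId W g))
    (\<lambda>a. HCmp W \<eta> (VId W a)) (\<lambda>b. HCmp W \<epsilon> (VId W b))"
proof -
  have A: "A \<in> Obj W" and B: "B \<in> Obj W" using f hom_Obj by auto
  have g: "g \<in> hom W B A" using adj f by (auto simp: adjunction_def homD)
  have gf: "Cmp W g f \<in> hom W A A" and fg: "Cmp W f g \<in> hom W B B" using f g Cmp_in_hom by auto
  have e: "\<eta> \<in> hom (hom_cat W A A) (Idt W A) (Cmp W g f)"
    and d: "\<epsilon> \<in> hom (hom_cat W B B) (Cmp W f g) (Idt W B)"
    and t1: "VCmp W (HCmp W \<epsilon> (VId W f)) (HCmp W (VId W f) \<eta>) = VId W f"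
    and t2: "VCmp W (HCmp W (VId W g) \<epsilon>) (HCmp W \<eta> (VId W g)) = VId W g"
    using adj f gf fg Idt_in_hom[OF A] Idt_in_hom[OF B] by (auto simp: adjunction_def homD hom_hom_cat)
  note Vf = VId_in_hom[OF f] and Vg = VId_in_hom[OF g]
  note VA = VId_in_hom[OF Idt_in_hom[OF A]] and VB = VId_in_hom[OF Idt_in_hom[OF B]]
  show ?thesis
  proof (rule functor_adjunctionI)
    show "is_functor (hom_cat W X A) (hom_cat W X B) (Cmp W f) (HCmp W (VId W f))"
      "is_functor (hom_cat W X B) (hom_cat W X A) (Cmp W g) (HCmp W (VId W g))"
      using f g X by (auto intro: postcomp_functor)
  next
    fix a assume "a \<in> Obj (hom_cat W X A)"
    then have a: "a \<in> hom W X A" by simp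
    show "HCmp W \<eta> (VId W a) \<in> hom (hom_cat W X A) a (Cmp W g (Cmp W f a))"
      using HCmp_in_hom[OF VId_in_hom[OF a] e] Cmp_assoc[OF a f g] Cmp_Idt_left[OF a] by simp
    have "VCmp W (HCmp W \<epsilon> (VId W (Cmp W f a))) (HCmp W (VId W f) (HCmp W \<eta> (VId W a))) =
        VCmp W (HCmp W (HCmp W \<epsilon> (VId W f)) (VId W a)) (HCmp W (HCmp W (VId W f) \<eta>) (VId W a))"
      using HCmp_assoc'[OF VId_in_hom[OF a] Vf d] HCmp_assoc'[OF VId_in_hom[OF a] e Vf] HCmp_VId[OF a f]
      by simp
    also have "\<dots> = HCmp W (VId W f) (VId W a)"
    proof -
      have "HCmp W \<epsilon> (VId W f) \<in> hom (hom_cat W A B) (Cmp W f (Cmp W g f)) f"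
        using HCmp_in_hom[OF Vf d] Cmp_assoc[OF f g f] Cmp_Idt_left[OF f] by simp
      from interchange[OF VId_in_hom[OF a] VId_in_hom[OF a] HCmp_in_hom[OF e Vf] this] t1
      show ?thesis using VCmp_VId(1)[OF VId_in_hom[OF a]] by simp
    qed
    also have "\<dots> = VId W (Cmp W f a)" using HCmp_VId[OF a f] .
    finally show "Cmp (hom_cat W X B) (HCmp W \<epsilon> (VId W (Cmp W f a))) (HCmp W (VId W f) (HCmp W \<eta> (VId W a))) =
        Idt (hom_cat W X B) (Cmp W f a)" by simp
  next
    fix b assume "b \<in> Obj (hom_cat W X B)"
    then have b: "b \<in> hom W X B" by simp
    show "HCmp W \<epsilon> (VId W b) \<in> hom (hom_cat W X B) (Cmp W f (Cmp W g b)) b"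
      using HCmp_in_hom[OF VId_in_hom[OF b] d] Cmp_assoc[OF b g f] Cmp_Idt_left[OF b] by simp
    have "VCmp W (HCmp W (VId W g) (HCmp W \<epsilon> (VId W b))) (HCmp W \<eta> (VId W (Cmp W g b))) =
        VCmp W (HCmp W (HCmp W (VId W g) \<epsilon>) (VId W b)) (HCmp W (HCmp W \<eta> (VId W g)) (VId W b))"
      using HCmp_assoc'[OF VId_in_hom[OF b] Vg e] HCmp_assoc'[OF VId_in_hom[OF b] d Vg] HCmp_VId[OF b g]
      by simp
    also have "\<dots> = HCmp W (VId W g) (VId W b)"
    proof -
      have "HCmp W \<eta> (VId W g) \<in> hom (hom_cat W B A) g (Cmp W g (Cmp W f g))"
        using HCmp_in_hom[OF Vg e] Cmp_assoc[OF g f g] Cmp_Idt_left[OF g] by simp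
      from interchange[OF VId_in_hom[OF b] VId_in_hom[OF b] this HCmp_in_hom[OF d Vg]] t2
      show ?thesis using VCmp_VId(1)[OF VId_in_hom[OF b]] by simp
    qed
    also have "\<dots> = VId W (Cmp W g b)" using HCmp_VId[OF b g] .
    finally show "Cmp (hom_cat W X A) (HCmp W (VId W g) (HCmp W \<epsilon> (VId W b))) (HCmp W \<eta> (VId W (Cmp W g b))) =
        Idt (hom_cat W X A) (Cmp W g b)" by simp
  next
    fix \<alpha> a a' assume al: "\<alpha> \<in> hom (hom_cat W X A) a a'"
    then have a: "a \<in> hom W X A" and a': "a' \<in> hom W X A" by (auto simp: hom_hom_cat)
    \<comment> \<open>Both sides of the naturality square are equal to the horizontal composite of
      \<open>\<eta>\<close> and \<open>\<alpha>\<close>.\<close>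
    have "VCmp W (HCmp W \<eta> (VId W a')) \<alpha> = HCmp W \<eta> \<alpha>"
      using interchange[OF al VId_in_hom[OF a'] VA e] HCmp_VId_Idt[OF al] VCmp_VId[OF e] VCmp_VId[OF al]
      by simp
    also have "\<dots> = VCmp W (HCmp W (VId W (Cmp W g f)) \<alpha>) (HCmp W \<eta> (VId W a))"
      using interchange[OF VId_in_hom[OF a] al e VId_in_hom[OF gf]] VCmp_VId[OF e] VCmp_VId[OF al] by simp
    finally show "Cmp (hom_cat W X A) (HCmp W \<eta> (VId W a')) \<alpha> =
        Cmp (hom_cat W X A) (HCmp W (VId W g) (HCmp W (VId W f) \<alpha>)) (HCmp W \<eta> (VId W a))"
      using HCmp_VId_VId[OF f g al] by simp
  next
    fix \<beta> b b' assume be: "\<beta> \<in> hom (hom_cat W X B) b b'"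
    then have b: "b \<in> hom W X B" and b': "b' \<in> hom W X B" by (auto simp: hom_hom_cat)
    have "VCmp W (HCmp W \<epsilon> (VId W b')) (HCmp W (VId W (Cmp W f g)) \<beta>) = HCmp W \<epsilon> \<beta>"
      using interchange[OF be VId_in_hom[OF b'] VId_in_hom[OF fg] d] VCmp_VId[OF d] VCmp_VId[OF be] by simp
    also have "\<dots> = VCmp W \<beta> (HCmp W \<epsilon> (VId W b))"
      using interchange[OF VId_in_hom[OF b] be d VB] HCmp_VId_Idt[OF be] VCmp_VId[OF d] VCmp_VId[OF be]
      by simp
    finally show "Cmp (hom_cat W X B) (HCmp W \<epsilon> (VId W b')) (HCmp W (VId W f) (HCmp W (VId W g) \<beta>)) =
        Cmp (hom_cat W X B) \<beta> (HCmp W \<epsilon> (VId W b))"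
      using HCmp_VId_VId[OF g f be] by simp
  qed
qed

lemma is_2product_inverse:
  assumes "is_2product W A B Q p q" "X \<in> Obj W"
  obtains Go Ga where "inverse_functors (hom_cat W X Q) (prod_cat (hom_cat W X A) (hom_cat W X B))
    (\<lambda>f. (Cmp W p f, Cmp W q f)) (\<lambda>\<alpha>. (HCmp W (VId W p) \<alpha>, HCmp W (VId W q) \<alpha>)) Go Ga"
  using assms unfolding is_2product_def is_cat_iso_iff by blast

text \<open>The object part of an isomorphism of hom-categories is a bijection. This makes the
  \<open>THE\<close> in \<open>pairing\<close> well defined.\<close>

lemma is_2product_ex1:
  assumes Q: "is_2product W A B Q p q" and f: "f \<in> hom W X A" and g: "g \<in> hom W X B"
  shows "\<exists>!h. h \<in> hom W X Q \<and> Cmp W p h = f \<and> Cmp W q h = g"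
proof -
  have X: "X \<in> Obj W" using f hom_Obj by auto
  obtain Go Ga where inv: "inverse_functors (hom_cat W X Q) (prod_cat (hom_cat W X A) (hom_cat W X B))
      (\<lambda>f. (Cmp W p f, Cmp W q f)) (\<lambda>\<alpha>. (HCmp W (VId W p) \<alpha>, HCmp W (VId W q) \<alpha>)) Go Ga"
    using is_2product_inverse[OF Q X] .
  then have G: "is_functor (prod_cat (hom_cat W X A) (hom_cat W X B)) (hom_cat W X Q) Go Ga"
    and 1: "\<And>h. h \<in> hom W X Q \<Longrightarrow> Go (Cmp W p h, Cmp W q h) = h"
    and 2: "Cmp W p (Go (f, g)) = f" "Cmp W q (Go (f, g)) = g"
    using f g by (auto simp: inverse_functors_def)
  have "Go (f, g) \<in> hom W X Q" using is_functor_Obj[OF G, of "(f, g)"] f g by simp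
  then show ?thesis using 1 2 by (intro ex1I[of _ "Go (f, g)"]) auto
qed

end

section \<open>Chosen finite products and the induced structure on hom(X, A)\<close>

locale two_category_with_products = two_category W
  for W :: "('o, 'm, 'c, 'z) two_cat_scheme" +
  fixes P :: "('o, 'm) products"
  assumes products: "finite_2products W P"
begin

lemma Prod_is_2product:
  "A \<in> Obj W \<Longrightarrow> B \<in> Obj W \<Longrightarrow> is_2product W A B (Prod P A B) (Pr1 P A B) (Pr2 P A B)"
  using products by (simp add: finite_2products_def)

lemma Prod_Pr:
  assumes "A \<in> Obj W" "B \<in> Obj W"
  shows "Prod P A B \<in> Obj W" "Pr1 P A B \<in> hom W (Prod P A B) A" "Pr2 P A B \<in> hom W (Prod P A B) B"
  using Prod_is_2product[OF assms] by (auto simp: is_2product_def)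

lemma pairing:
  assumes f: "f \<in> hom W X A" and g: "g \<in> hom W X B"
  shows "pairing W P f g \<in> hom W X (Prod P A B)"
    and "Cmp W (Pr1 P A B) (pairing W P f g) = f" and "Cmp W (Pr2 P A B) (pairing W P f g) = g"
proof -
  have "A \<in> Obj W" "B \<in> Obj W" using f g hom_Obj by auto
  from theI'[OF is_2product_ex1[OF Prod_is_2product[OF this] f g]]
  show "pairing W P f g \<in> hom W X (Prod P A B)"
    and "Cmp W (Pr1 P A B) (pairing W P f g) = f" and "Cmp W (Pr2 P A B) (pairing W P f g) = g"
    using homD[OF f] homD[OF g] by (simp_all add: pairing_def)
qed

lemma One_inverse:
  assumes "X \<in> Obj W"
  obtains Go Ga where "inverse_functors (hom_cat W X (One P)) unit_cat (\<lambda>_. ()) (\<lambda>_. ()) Go Ga"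
  using assms products unfolding finite_2products_def is_2terminal_def is_cat_iso_iff by blast

lemma bang_in_hom:
  assumes A: "A \<in> Obj W" shows "bang W P A \<in> hom W A (One P)"
proof -
  obtain Go Ga where inv: "inverse_functors (hom_cat W A (One P)) unit_cat (\<lambda>_. ()) (\<lambda>_. ()) Go Ga"
    using One_inverse[OF A] .
  then have "Go () \<in> hom W A (One P)" "\<And>h. h \<in> hom W A (One P) \<Longrightarrow> Go () = h"
    by (auto simp: inverse_functors_def is_functor_def Obj_unit_cat)
  then have "\<exists>!h. h \<in> hom W A (One P)" by blast
  from theI'[OF this] show ?thesis by (simp add: bang_def)
qed

text \<open>The four equations say that composing with the internal diagonal and then splitting into
  components is the diagonal functor of hom(X, A), on morphisms and on 2-cells. This is what
  \<open>product_of_adjunction\<close> asks for.\<close>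

lemma diagonal:
  assumes A: "A \<in> Obj W"
  shows "diagonal W P A \<in> hom W A (Prod P A A)"
    and "a \<in> hom W X A \<Longrightarrow> Cmp W (Pr1 P A A) (Cmp W (diagonal W P A) a) = a"
    and "a \<in> hom W X A \<Longrightarrow> Cmp W (Pr2 P A A) (Cmp W (diagonal W P A) a) = a"
    and "\<alpha> \<in> Arr (hom_cat W X A) \<Longrightarrow>
      HCmp W (VId W (Pr1 P A A)) (HCmp W (VId W (diagonal W P A)) \<alpha>) = \<alpha>"
    and "\<alpha> \<in> Arr (hom_cat W X A) \<Longrightarrow>
      HCmp W (VId W (Pr2 P A A)) (HCmp W (VId W (diagonal W P A)) \<alpha>) = \<alpha>"
proof -
  note I = Idt_in_hom[OF A] and p = Prod_Pr(2,3)[OF A A]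
  note d = pairing[OF I I, folded diagonal_def]
  show "diagonal W P A \<in> hom W A (Prod P A A)" by (rule d(1))
  show "Cmp W (Pr1 P A A) (Cmp W (diagonal W P A) a) = a" if "a \<in> hom W X A"
    using Cmp_assoc[OF that d(1) p(1)] Cmp_Idt_left[OF that] d(2) by simp
  show "Cmp W (Pr2 P A A) (Cmp W (diagonal W P A) a) = a" if "a \<in> hom W X A"
    using Cmp_assoc[OF that d(1) p(2)] Cmp_Idt_left[OF that] d(3) by simp
  show "HCmp W (VId W (Pr1 P A A)) (HCmp W (VId W (diagonal W P A)) \<alpha>) = \<alpha>"
    if "\<alpha> \<in> Arr (hom_cat W X A)"
    using HCmp_VId_VId[OF d(1) p(1) Arr_in_hom[OF that]] HCmp_VId_Idt[OF Arr_in_hom[OF that]] d(2) by simp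
  show "HCmp W (VId W (Pr2 P A A)) (HCmp W (VId W (diagonal W P A)) \<alpha>) = \<alpha>"
    if "\<alpha> \<in> Arr (hom_cat W X A)"
    using HCmp_VId_VId[OF d(1) p(2) Arr_in_hom[OF that]] HCmp_VId_Idt[OF Arr_in_hom[OF that]] d(3) by simp
qed

lemma hom_cat_has_finite_products:
  assumes A: "A \<in> Obj W" and X: "X \<in> Obj W"
    and T: "has_internal_terminal W P A" and M: "has_internal_products W P A"
  shows "has_finite_products (hom_cat W X A)"
proof -
  obtain t \<eta> \<epsilon> where t: "adjunction W (bang W P A) t \<eta> \<epsilon>"
    using T by (auto simp: has_internal_terminal_def has_right_adjoint_def is_right_adjoint_def)
  obtain m \<eta>' \<epsilon>' where m: "adjunction W (diagonal W P A) m \<eta>' \<epsilon>'"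
    using M by (auto simp: has_internal_products_def has_right_adjoint_def is_right_adjoint_def)
  obtain To Ta where "inverse_functors (hom_cat W X (One P)) unit_cat (\<lambda>_. ()) (\<lambda>_. ()) To Ta"
    using One_inverse[OF X] .
  note t' = functor_adjunction_comp[OF postcomp_adjunction[OF t bang_in_hom[OF A] X]
      inverse_functors_adjunction[OF this]]
  obtain Go Ga where "inverse_functors (hom_cat W X (Prod P A A)) (prod_cat (hom_cat W X A) (hom_cat W X A))
    (\<lambda>f. (Cmp W (Pr1 P A A) f, Cmp W (Pr2 P A A) f))
    (\<lambda>\<alpha>. (HCmp W (VId W (Pr1 P A A)) \<alpha>, HCmp W (VId W (Pr2 P A A)) \<alpha>)) Go Ga"
    using is_2product_inverse[OF Prod_is_2product[OF A A] X] .
  note m' = functor_adjunction_comp[OF postcomp_adjunction[OF m diagonal(1)[OF A] X]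
      inverse_functors_adjunction[OF this]]
  show ?thesis
    by (rule has_finite_products_of_adjunctions[OF t' m']) (simp_all add: diagonal[OF A])
qed

lemma hom_cat_has_finite_coproducts:
  assumes A: "A \<in> Obj W" and X: "X \<in> Obj W" and cocart: "internally_cocartesian W P A"
  shows "has_finite_coproducts (hom_cat W X A)"
proof -
  let ?C = "op_cat (hom_cat W X A)"
  obtain t \<eta> \<epsilon> where t: "adjunction W t (bang W P A) \<eta> \<epsilon>"
    using cocart
    by (auto simp: internally_cocartesian_def has_internal_initial_def has_left_adjoint_def is_right_adjoint_def)
  obtain l \<eta>' \<epsilon>' where l: "adjunction W l (diagonal W P A) \<eta>' \<epsilon>'"
    using cocart
    by (auto simp: internally_cocartesian_def has_internal_coproducts_def has_left_adjoint_def is_right_adjoint_def)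
  \<comment> \<open>The endpoints of the left adjoints are forced by those of \<open>bang\<close>
    and \<open>diagonal\<close>.\<close>
  have tA: "t \<in> hom W (One P) A" and lA: "l \<in> hom W (Prod P A A) A"
    using t l bang_in_hom[OF A] diagonal(1)[OF A] by (auto simp: adjunction_def hom_def)
  obtain To Ta where "inverse_functors (hom_cat W X (One P)) unit_cat (\<lambda>_. ()) (\<lambda>_. ()) To Ta"
    using One_inverse[OF X] .
  from inverse_functors_op_cat[OF this]
  have "inverse_functors (op_cat (hom_cat W X (One P))) unit_cat (\<lambda>_. ()) (\<lambda>_. ()) To Ta"
    by (simp add: op_cat_unit_cat)
  note t' = functor_adjunction_comp[OF functor_adjunction_op_cat[OF postcomp_adjunction[OF t tA X]]
      inverse_functors_adjunction[OF this]]
  obtain Go Ga where "inverse_functors (hom_cat W X (Prod P A A)) (prod_cat (hom_cat W X A) (hom_cat W X A))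
    (\<lambda>f. (Cmp W (Pr1 P A A) f, Cmp W (Pr2 P A A) f))
    (\<lambda>\<alpha>. (HCmp W (VId W (Pr1 P A A)) \<alpha>, HCmp W (VId W (Pr2 P A A)) \<alpha>)) Go Ga"
    using is_2product_inverse[OF Prod_is_2product[OF A A] X] .
  from inverse_functors_op_cat[OF this]
  have "inverse_functors (op_cat (hom_cat W X (Prod P A A))) (prod_cat ?C ?C)
    (\<lambda>f. (Cmp W (Pr1 P A A) f, Cmp W (Pr2 P A A) f))
    (\<lambda>\<alpha>. (HCmp W (VId W (Pr1 P A A)) \<alpha>, HCmp W (VId W (Pr2 P A A)) \<alpha>)) Go Ga"
    by (simp add: op_cat_prod_cat)
  note l' = functor_adjunction_comp[OF functor_adjunction_op_cat[OF postcomp_adjunction[OF l lA X]]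
      inverse_functors_adjunction[OF this]]
  have "has_finite_products ?C"
    by (rule has_finite_products_of_adjunctions[OF t' l']) (simp_all add: diagonal[OF A])
  then show ?thesis by (rule has_finite_coproducts_op_cat)
qed

text \<open>
  Under \<open>hom(X, A \<times> S) \<cong> hom(X, A) \<times> hom(X, S)\<close>, composition with \<open>\<langle>m \<circ> (id \<times> e), \<pi>\<^sub>S\<rangle>\<close> becomes
  the functor \<open>(a, s) \<mapsto> (a \<times> (e \<circ> s), s)\<close>. If \<open>hom(X, S)\<close> is discrete, the counit of its right
  adjoint at \<open>(c, s)\<close> is the evaluation of an exponential of \<open>c\<close> by \<open>e \<circ> s\<close>.
\<close>

lemma hom_cat_exponential:
  assumes A: "A \<in> Obj W" and X: "X \<in> Obj W" and e: "e \<in> hom W S A"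
    and m: "adjunction W (diagonal W P A) m \<eta> \<epsilon>"
    and r: "adjunction W (pairing W P (Cmp W m (prod_map W P (Idt W A) e)) (Pr2 P A S)) r \<eta>' \<epsilon>'"
    and discrete: "\<And>s t \<sigma>. \<sigma> \<in> hom (hom_cat W X S) s t \<Longrightarrow> s = t \<and> \<sigma> = VId W s"
    and s: "s \<in> hom W X S" and c: "c \<in> hom W X A"
  shows "\<exists>x p \<pi>1 \<pi>2 ev. is_exponential (hom_cat W X A) (Cmp W e s) c x p \<pi>1 \<pi>2 ev"
proof -
  let ?C = "hom_cat W X A" and ?S = "hom_cat W X S"
  let ?p = "Pr1 P A A" and ?q = "Pr2 P A A" and ?p' = "Pr1 P A S" and ?q' = "Pr2 P A S"
  define n where "n = prod_map W P (Idt W A) e"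
  define k where "k = pairing W P (Cmp W m n) ?q'"
  have S: "S \<in> Obj W" using e hom_Obj by auto
  note pr = Prod_Pr(2,3)[OF A A] and pr' = Prod_Pr(2,3)[OF A S]
  have mA: "m \<in> hom W (Prod P A A) A"
    using m homD[OF diagonal(1)[OF A]] by (auto simp: adjunction_def)
  have ip: "Cmp W (Idt W A) ?p' = ?p'" using Cmp_Idt_left[OF pr'(1)] .
  have eq: "Cmp W e ?q' \<in> hom W (Prod P A S) A" using Cmp_in_hom[OF pr'(2) e] .
  \<comment> \<open>With the identity removed, n is a pairing of known morphisms and its projections
    can be computed.\<close>
  have n_eq: "n = pairing W P ?p' (Cmp W e ?q')"
    using homD[OF Idt_in_hom[OF A]] homD[OF e] ip by (simp add: n_def prod_map_def)
  note n = pairing[OF pr'(1) eq, folded n_eq]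
  note mn = Cmp_in_hom[OF n(1) mA]
  note k = pairing[OF mn pr'(2), folded k_def]
  obtain Go Ga where G: "inverse_functors (hom_cat W X (Prod P A A)) (prod_cat ?C ?C)
    (\<lambda>f. (Cmp W ?p f, Cmp W ?q f)) (\<lambda>\<alpha>. (HCmp W (VId W ?p) \<alpha>, HCmp W (VId W ?q) \<alpha>)) Go Ga"
    using is_2product_inverse[OF Prod_is_2product[OF A A] X] .
  obtain Ho Ha where H: "inverse_functors (hom_cat W X (Prod P A S)) (prod_cat ?C ?S)
    (\<lambda>f. (Cmp W ?p' f, Cmp W ?q' f)) (\<lambda>\<alpha>. (HCmp W (VId W ?p') \<alpha>, HCmp W (VId W ?q') \<alpha>)) Ho Ha"
    using is_2product_inverse[OF Prod_is_2product[OF A S] X] .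
  note m' = functor_adjunction_comp[OF postcomp_adjunction[OF m diagonal(1)[OF A] X]
      inverse_functors_adjunction[OF G]]
  have "adjunction W k r \<eta>' \<epsilon>'" using r by (simp add: k_def n_def)
  \<comment> \<open>Conjugation by H: an adjunction between endofunctors of
    \<open>hom(X, A \<times> S)\<close> is moved to the product of hom(X, A) and hom(X, S).\<close>
  note r' = functor_adjunction_comp[OF inverse_functors_adjunction[OF inverse_functors_sym[OF H]]
      functor_adjunction_comp[OF postcomp_adjunction[OF this k(1) X] inverse_functors_adjunction[OF H]]]
  have Ho: "Ho (a, t) \<in> hom W X (Prod P A S)" "Cmp W ?p' (Ho (a, t)) = a" "Cmp W ?q' (Ho (a, t)) = t"
    if "a \<in> hom W X A" "t \<in> hom W X S" for a t
  proof -
    have "(a, t) \<in> Obj (prod_cat ?C ?S)" using that by simp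
    then have "Ho (a, t) \<in> Obj (hom_cat W X (Prod P A S))"
      and "(Cmp W ?p' (Ho (a, t)), Cmp W ?q' (Ho (a, t))) = (a, t)"
      using H unfolding inverse_functors_def by (blast intro: is_functor_Obj)+
    then show "Ho (a, t) \<in> hom W X (Prod P A S)" "Cmp W ?p' (Ho (a, t)) = a" "Cmp W ?q' (Ho (a, t)) = t"
      by simp_all
  qed
  have Ha: "Ha (\<alpha>, \<tau>) \<in> hom (hom_cat W X (Prod P A S)) (Ho (a, t)) (Ho (a', t'))"
    "HCmp W (VId W ?p') (Ha (\<alpha>, \<tau>)) = \<alpha>" "HCmp W (VId W ?q') (Ha (\<alpha>, \<tau>)) = \<tau>"
    if "\<alpha> \<in> hom ?C a a'" "\<tau> \<in> hom ?S t t'" for \<alpha> \<tau> a a' t t'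
  proof -
    have *: "(\<alpha>, \<tau>) \<in> hom (prod_cat ?C ?S) (a, t) (a', t')" using that by simp
    have "(HCmp W (VId W ?p') (Ha (\<alpha>, \<tau>)), HCmp W (VId W ?q') (Ha (\<alpha>, \<tau>))) = (\<alpha>, \<tau>)"
      using H homD[OF *] unfolding inverse_functors_def by blast
    then show "HCmp W (VId W ?p') (Ha (\<alpha>, \<tau>)) = \<alpha>" "HCmp W (VId W ?q') (Ha (\<alpha>, \<tau>)) = \<tau>" by auto
    show "Ha (\<alpha>, \<tau>) \<in> hom (hom_cat W X (Prod P A S)) (Ho (a, t)) (Ho (a', t'))"
      using H is_functor_hom[OF _ *] by (auto simp: inverse_functors_def)
  qed
  have Go: "Go (Cmp W ?p h, Cmp W ?q h) = h" if "h \<in> hom W X (Prod P A A)" for h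
    using G that by (auto simp: inverse_functors_def)
  have Ga: "Ga (HCmp W (VId W ?p) \<beta>, HCmp W (VId W ?q) \<beta>) = \<beta>"
    if "\<beta> \<in> hom (hom_cat W X (Prod P A A)) h h'" for \<beta> h h'
    using G homD[OF that] by (auto simp: inverse_functors_def)
  show ?thesis
  proof (rule exponential_of_adjunctions[OF m' _ _ r', where \<Phi> = "Cmp W e" and s = s])
    show "\<forall>x\<in>Obj ?C. (Cmp W ?p (Cmp W (diagonal W P A) x), Cmp W ?q (Cmp W (diagonal W P A) x)) = (x, x)"
      by (simp add: diagonal[OF A])
    show "\<forall>f\<in>Arr ?C. (HCmp W (VId W ?p) (HCmp W (VId W (diagonal W P A)) f),
        HCmp W (VId W ?q) (HCmp W (VId W (diagonal W P A)) f)) = (f, f)"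
      by (simp add: diagonal[OF A])
  next
    fix a t assume "a \<in> Obj ?C" "t \<in> Obj ?S"
    then have a: "a \<in> hom W X A" and t: "t \<in> hom W X S" by auto
    let ?h = "Ho (a, t)"
    note h = Ho[OF a t]
    \<comment> \<open>The projections of this composite are a and \<open>e \<circ> t\<close>, and a
      morphism into \<open>A \<times> A\<close> is \<open>Go\<close> of its projections. Applying m
      then gives the product of a and \<open>e \<circ> t\<close>.\<close>
    have "Cmp W n ?h = Go (a, Cmp W e t)"
      using Go[OF Cmp_in_hom[OF h(1) n(1)]] Cmp_assoc[OF h(1) n(1) pr(1)] Cmp_assoc[OF h(1) n(1) pr(2)]
        Cmp_assoc[OF h(1) pr'(2) e] n(2,3) h(2,3) by simp
    then show "(Cmp W ?p' (Cmp W k ?h), Cmp W ?q' (Cmp W k ?h)) = (Cmp W m (Go (a, Cmp W e t)), t)"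
      using Cmp_assoc[OF h(1) k(1) pr'(1)] Cmp_assoc[OF h(1) k(1) pr'(2)]
        Cmp_assoc[OF h(1) n(1) mA] k(2,3) h(3) by simp
  next
    fix \<alpha> a a' t assume al: "\<alpha> \<in> hom ?C a a'" and "t \<in> Obj ?S"
    then have t: "t \<in> hom W X S" by simp
    let ?h = "Ha (\<alpha>, VId W t)"
    note h = Ha[OF al VId_in_hom[OF t]]
    \<comment> \<open>The same computation on 2-cells, with an identity in the second
      variable.\<close>
    have "HCmp W (VId W n) ?h = Ga (\<alpha>, VId W (Cmp W e t))"
      using Ga[OF HCmp_in_hom[OF h(1) VId_in_hom[OF n(1)]]]
        HCmp_VId_VId[OF n(1) pr(1) h(1)] HCmp_VId_VId[OF n(1) pr(2) h(1)]
        HCmp_VId_VId[OF pr'(2) e h(1)] HCmp_VId[OF t e] n(2,3) h(2,3) by simp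
    then show "(HCmp W (VId W ?p') (HCmp W (VId W k) (Ha (\<alpha>, Idt ?S t))),
        HCmp W (VId W ?q') (HCmp W (VId W k) (Ha (\<alpha>, Idt ?S t)))) =
        (HCmp W (VId W m) (Ga (\<alpha>, Idt ?C (Cmp W e t))), Idt ?S t)"
      using HCmp_VId_VId[OF k(1) pr'(1) h(1)] HCmp_VId_VId[OF k(1) pr'(2) h(1)]
        HCmp_VId_VId[OF n(1) mA h(1)] k(2,3) h(3) by simp
  next
    show "category ?S" using X S by (rule hom_category)
  next
    show "\<And>t. t \<in> Obj ?S \<Longrightarrow> Cmp W e t \<in> Obj ?C" using Cmp_in_hom e by simp
  next
    show "\<And>t u \<sigma>. \<sigma> \<in> hom ?S t u \<Longrightarrow> t = u \<and> \<sigma> = Idt ?S t" using discrete by simp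
  qed (use s c in simp_all)
qed

end

section \<open>Consequences of discreteness\<close>

lemma discrete_hom_cat:
  assumes D: "notion_of_discreteness W D" and x: "x \<in> Obj (Base D)" and y: "y \<in> Obj (Base D)"
    and \<sigma>: "\<sigma> \<in> hom (hom_cat W (FObj D x) (FObj D y)) s t"
  shows "s = t \<and> \<sigma> = VId W s"
proof -
  let ?S = "discrete_cat (hom (Base D) x y)" and ?H = "hom_cat W (FObj D x) (FObj D y)"
  obtain Go Ga where "inverse_functors ?S ?H (FArr D) (\<lambda>f. VId W (FArr D f)) Go Ga"
    using D x y unfolding notion_of_discreteness_def two_fully_faithful_def is_cat_iso_iff by blast
  then have F: "is_functor ?S ?H (FArr D) (\<lambda>f. VId W (FArr D f))" and G: "is_functor ?H ?S Go Ga"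
    and inv: "VId W (FArr D (Ga \<sigma>)) = \<sigma>"
    using homD[OF \<sigma>] by (auto simp: inverse_functors_def)
  \<comment> \<open>In \<open>discrete_cat\<close> an element is its own domain and codomain, so the
    functor back sends it to an identity 2-cell, and that 2-cell is \<open>\<sigma>\<close>.\<close>
  have "Ga \<sigma> \<in> hom ?S (Ga \<sigma>) (Ga \<sigma>)"
    using is_functor_hom[OF G \<sigma>] by (auto simp: discrete_cat_def hom_def)
  from is_functor_hom[OF F this] show ?thesis using inv homD[OF \<sigma>] by (auto dest: homD)
qed

text \<open>The factor is the image under \<open>FArr\<close> of the transpose of b along the
  adjunction between \<open>FObj\<close> and \<open>UObj\<close>.\<close>

lemma factor_through_counit:
  assumes D: "notion_of_discreteness W D" and x: "x \<in> Obj (Base D)" and b: "b \<in> hom W (FObj D x) A"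
  shows "\<exists>s \<in> hom W (FObj D x) (underlying D A). b = Cmp W (Counit D A) s"
proof -
  have adj: "functor_adjunction (Base D) W (FObj D) (FArr D) (UObj D) (UArr D) (Unit D) (Counit D)"
    using D by (simp add: notion_of_discreteness_def)
  interpret category W using functor_adjunctionD(1)[OF adj] by (rule is_functor_category)
  have "A \<in> Obj W" using b hom_Obj by auto
  from functor_adjunction_universal[OF adj x this b]
  obtain a where "a \<in> hom (Base D) x (UObj D A)" "Cmp W (Counit D A) (FArr D a) = b" by blast
  then show ?thesis
    using is_functor_hom[OF functor_adjunctionD(1)[OF adj]] by (auto simp: underlying_def)
qed

theorem theorem1:
  fixes W :: "('o, 'm, 'c) two_cat"
    and P :: "('o, 'm) products"
    and D :: "('x, 'y, 'o, 'm) discreteness"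
    and A :: 'o
  assumes "two_category W"
    and "finite_2products W P"
    and "notion_of_discreteness W D"
    and "A \<in> Obj W"
    and "internally_cartesian_closed W P D A"
  shows "(\<forall>X\<in>discrete_objects D. cartesian_closed (hom_cat W X A)) \<and>
         (internally_cocartesian W P A \<longrightarrow>
            (\<forall>X\<in>discrete_objects D. has_finite_coproducts (hom_cat W X A)))"
proof -
  interpret two_category_with_products W P
    using assms(1,2) by (simp add: two_category_with_products_def two_category_with_products_axioms_def)
  have adj: "functor_adjunction (Base D) W (FObj D) (FArr D) (UObj D) (UArr D) (Unit D) (Counit D)"
    using assms(3) by (simp add: notion_of_discreteness_def)
  note F = functor_adjunctionD(1)[OF adj]
  have UA: "UObj D A \<in> Obj (Base D)"
    using is_functor_Obj[OF functor_adjunctionD(2)[OF adj] assms(4)] .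
  have counit: "Counit D A \<in> hom W (underlying D A) A"
    using functor_adjunctionD(4)[OF adj assms(4)] by (simp add: underlying_def)
  obtain m \<eta> \<epsilon> r \<eta>' \<epsilon>' where m: "adjunction W (diagonal W P A) m \<eta> \<epsilon>"
    and r: "adjunction W (closure_map W P D A m) r \<eta>' \<epsilon>'"
    using assms(5)
    by (auto simp: internally_cartesian_closed_def is_right_adjoint_def has_right_adjoint_def)
  have ccc: "cartesian_closed (hom_cat W (FObj D x) A)" if x: "x \<in> Obj (Base D)" for x
    unfolding cartesian_closed_def
  proof (intro conjI ballI)
    have X: "FObj D x \<in> Obj W" using is_functor_Obj[OF F x] .
    show "category (hom_cat W (FObj D x) A)" using X assms(4) by (rule hom_category)
    show "has_finite_products (hom_cat W (FObj D x) A)"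
      using hom_cat_has_finite_products[OF assms(4) X] assms(5)
      by (simp add: internally_cartesian_closed_def)
    fix b c assume "b \<in> Obj (hom_cat W (FObj D x) A)" and c: "c \<in> Obj (hom_cat W (FObj D x) A)"
    then obtain s where s: "s \<in> hom W (FObj D x) (underlying D A)" "b = Cmp W (Counit D A) s"
      using factor_through_counit[OF assms(3) x] by auto
    show "\<exists>e p \<pi>1 \<pi>2 ev. is_exponential (hom_cat W (FObj D x) A) b c e p \<pi>1 \<pi>2 ev"
      unfolding s(2)
    proof (rule hom_cat_exponential[OF assms(4) X counit m r[unfolded closure_map_def] _ s(1)])
      \<comment> \<open>\<open>|A|\<close> is itself an image under \<open>FObj\<close>, namely of
        \<open>UObj D A\<close>, so both ends of this hom-category are discrete objects.\<close>
      show "s = t \<and> \<sigma> = VId W s" if "\<sigma> \<in> hom (hom_cat W (FObj D x) (underlying D A)) s t" for s t \<sigma>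
        using discrete_hom_cat[OF assms(3) x UA] that by (simp add: underlying_def)
      show "c \<in> hom W (FObj D x) A" using c by simp
    qed
  qed
  show ?thesis
    using ccc hom_cat_has_finite_coproducts[OF assms(4)] is_functor_Obj[OF F]
    by (auto simp: discrete_objects_def)
qed

end
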